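(* Let $G$ be a countable group with a uniformly discrete, proper, left-invariant metric $d$, and suppose $G$ has relative property A with respect to a finite family of subgroups $\{H_i\}_{i=1}^n$. If each $H_i$ (with the restricted metric) is coarsely embeddable, then $G$ is coarsely embeddable.
   Context: A metric is uniformly discrete if distinct points are at distance at least some fixed $\delta>0$; a metric on a group is proper if every ball is finite. A metric space $(X,d)$ is coarsely embeddable if there exist a Hilbert space $\mathcal{H}$, a map $\phi : X\to\mathcal{H}$ and nondecreasing maps $\rho_-,\rho_+ : [0,\infty)\to\mathbb{R}$ with $\lim_{r\to\infty}\rho_\pm(r)=\infty$ such that $\rho_-(d(x,y))\le\|\phi(x)-\phi(y)\|\le\rho_+(d(x,y))$ for all $x,y\in X$. Relative property A: let $K=\bigsqcup_{i=1}^n G/H_i$. $G$ has relative property A with respect to $\{H_1,\ldots,H_n\}$ if for every $R>0$ and $\epsilon>0$ there exist $S>0$ and a collection $(A_x)_{x\in G}$ of finite nonempty subsets of $K\times\mathbb{N}$ such that: (1) for all $x,y\in G$ with $d(x,y)<R$, $\frac{|A_x\,\Delta\,A_y|}{|A_x|}<\epsilon$; (2) for each $x\in G$, if $(aH_i,n)\in A_x$ then $d(x,aH_i)<S$, where $d(x,aH_i)=\inf_{h\in H_i}d(x,ah)$. *)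

theory Defs
  imports "HOL-Analysis.Analysis" "HOL-Algebra.Left_Coset"
begin

definition uniformly_discrete :: "'a set \<Rightarrow> ('a \<Rightarrow> 'a \<Rightarrow> real) \<Rightarrow> bool" where
  "uniformly_discrete X d \<longleftrightarrow>
     (\<exists>\<delta>>0. \<forall>x\<in>X. \<forall>y\<in>X. x \<noteq> y \<longrightarrow> \<delta> \<le> d x y)"

definition proper_metric :: "'a set \<Rightarrow> ('a \<Rightarrow> 'a \<Rightarrow> real) \<Rightarrow> bool" where
  "proper_metric X d \<longleftrightarrow> (\<forall>x\<in>X. \<forall>r. finite (Metric_space.mball X d x r))"

definition left_invariant :: "('a, 'b) monoid_scheme \<Rightarrow> ('a \<Rightarrow> 'a \<Rightarrow> real) \<Rightarrow> bool" where
  "left_invariant G d \<longleftrightarrow>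
     (\<forall>g\<in>carrier G. \<forall>x\<in>carrier G. \<forall>y\<in>carrier G.
        d (g \<otimes>\<^bsub>G\<^esub> x) (g \<otimes>\<^bsub>G\<^esub> y) = d x y)"

text \<open>
  HOL cannot quantify over types inside a formula, so "there exists a Hilbert space" is rendered by
  quantifying over a carrier \<open>V\<close> and an inner product \<open>ip\<close> on it. The linear structure of \<open>V\<close>
  is inherited from an ambient real vector space type, which serves only as a universe: no relation
  between \<open>ip\<close> and any norm or topology of the ambient type is assumed. For countable metric spaces
  the universe \<open>nat \<Rightarrow>\<^sub>C real\<close> of bounded sequences is no restriction: its linear dimension is that of
  the continuum, so it contains a linear copy of every separable Hilbert space.
\<close>

definition ip_norm :: "('v \<Rightarrow> 'v \<Rightarrow> real) \<Rightarrow> 'v \<Rightarrow> real" where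
  "ip_norm ip v = sqrt (ip v v)"

definition hilbert_space_on :: "'v::real_vector set \<Rightarrow> ('v \<Rightarrow> 'v \<Rightarrow> real) \<Rightarrow> bool" where
  "hilbert_space_on V ip \<longleftrightarrow>
     subspace V \<and>
     (\<forall>x\<in>V. \<forall>y\<in>V. ip x y = ip y x) \<and>
     (\<forall>x\<in>V. \<forall>y\<in>V. \<forall>z\<in>V. ip (x + y) z = ip x z + ip y z) \<and>
     (\<forall>c. \<forall>x\<in>V. \<forall>y\<in>V. ip (c *\<^sub>R x) y = c * ip x y) \<and>
     (\<forall>x\<in>V. 0 \<le> ip x x) \<and>
     (\<forall>x\<in>V. ip x x = 0 \<longrightarrow> x = 0) \<and>
     Metric_space.mcomplete V (\<lambda>x y. ip_norm ip (x - y))"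

lemma hilbert_space_on_UNIV_inner:
  "hilbert_space_on (UNIV :: 'h::{real_inner, complete_space} set) (\<bullet>)"
proof -
  have "(\<lambda>x y. ip_norm (\<bullet>) (x - y)) = (dist :: 'h \<Rightarrow> 'h \<Rightarrow> real)"
    by (simp add: fun_eq_iff ip_norm_def dist_norm norm_eq_sqrt_inner)
  moreover have "Met_TC.mcomplete TYPE('h)"
    by (simp add: complete_UNIV)
  ultimately show ?thesis
    by (simp add: hilbert_space_on_def inner_commute inner_add_right)
qed

text \<open>The first argument of the next definition is the ambient universe of the Hilbert space.\<close>

definition coarsely_embeddable ::
  "'v::real_vector itself \<Rightarrow> 'a set \<Rightarrow> ('a \<Rightarrow> 'a \<Rightarrow> real) \<Rightarrow> bool" where
  "coarsely_embeddable U X d \<longleftrightarrow>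
     (\<exists>(V :: 'v set) ip (\<phi> :: 'a \<Rightarrow> 'v) (\<rho>\<^sub>1 :: real \<Rightarrow> real) (\<rho>\<^sub>2 :: real \<Rightarrow> real).
        hilbert_space_on V ip \<and> \<phi> ` X \<subseteq> V \<and>
        mono_on {0..} \<rho>\<^sub>1 \<and> mono_on {0..} \<rho>\<^sub>2 \<and>
        filterlim \<rho>\<^sub>1 at_top at_top \<and> filterlim \<rho>\<^sub>2 at_top at_top \<and>
        (\<forall>x\<in>X. \<forall>y\<in>X. \<rho>\<^sub>1 (d x y) \<le> ip_norm ip (\<phi> x - \<phi> y) \<and>
                       ip_norm ip (\<phi> x - \<phi> y) \<le> \<rho>\<^sub>2 (d x y)))"

text \<open>
  The disjoint union of the coset spaces: a coset \<open>C\<close> of the \<open>i\<close>-th subgroup appears as \<open>(i, C)\<close>.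
\<close>

definition coset_union :: "('a, 'b) monoid_scheme \<Rightarrow> nat \<Rightarrow> (nat \<Rightarrow> 'a set) \<Rightarrow> (nat \<times> 'a set) set" where
  "coset_union G n H = (SIGMA i:{1..n}. lcosets\<^bsub>G\<^esub> (H i))"

definition relative_property_A ::
  "('a, 'b) monoid_scheme \<Rightarrow> ('a \<Rightarrow> 'a \<Rightarrow> real) \<Rightarrow> nat \<Rightarrow> (nat \<Rightarrow> 'a set) \<Rightarrow> bool" where
  "relative_property_A G d n H \<longleftrightarrow>
     (\<forall>R>0. \<forall>\<epsilon>>0. \<exists>S>0. \<exists>A :: 'a \<Rightarrow> ((nat \<times> 'a set) \<times> nat) set.
        (\<forall>x\<in>carrier G. finite (A x) \<and> A x \<noteq> {} \<and> A x \<subseteq> coset_union G n H \<times> UNIV) \<and>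
        (\<forall>x\<in>carrier G. \<forall>y\<in>carrier G. d x y < R \<longrightarrow>
           real (card (sym_diff (A x) (A y))) / real (card (A x)) < \<epsilon>) \<and>
        (\<forall>x\<in>carrier G. \<forall>i C k. ((i, C), k) \<in> A x \<longrightarrow> (INF c\<in>C. d x c) < S))"

end

theory Submission
  imports Defs
begin

text \<open>
  Fix \<open>R\<close> and \<open>\<epsilon>\<close>, and let \<open>A\<^sub>x\<close> be the sets given by relative property A. For a coset \<open>aH\<^sub>i\<close> occurring
  in \<open>A\<^sub>x\<close> choose a point \<open>p\<close> of it at distance less than \<open>S\<close> from \<open>x\<close>, and let \<open>u\<close> map \<open>x\<close> to the image
  of \<open>a\<^sup>-\<^sup>1p\<close> under the coarse embedding of \<open>H\<^sub>i\<close>. The average over \<open>A\<^sub>x \<inter> A\<^sub>y\<close>, normalized by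
  \<open>\<surd>(|A\<^sub>x||A\<^sub>y|)\<close>, of the Gaussian kernels \<open>exp (-t \<parallel>u x - u y\<parallel>\<^sup>2)\<close> is positive semidefinite, for small \<open>t\<close>
  it is close to 1 when \<open>d x y < R\<close>, and it tends to 0 as \<open>d x y \<rightarrow> \<infinity>\<close>. Given such kernels \<open>k\<^sub>m\<close> with
  \<open>R = m + 1\<close> and error \<open>2\<^sup>-\<^sup>m\<close>, the sum of \<open>1 - k\<^sub>m\<close> is a proper function of conditionally negative type,
  hence the squared distance of vectors in a Hilbert space. For a countable group a Cholesky
  factorization realizes these vectors as finitely supported sequences.
\<close>

section \<open>Positive semidefinite kernels\<close>

text \<open>Symmetry is a separate clause because over the reals the quadratic form sees only the
  symmetric part of \<open>k\<close>.\<close>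

definition psd_kernel :: "'a set \<Rightarrow> ('a \<Rightarrow> 'a \<Rightarrow> real) \<Rightarrow> bool" where
  "psd_kernel X k \<longleftrightarrow>
     (\<forall>x\<in>X. \<forall>y\<in>X. k x y = k y x) \<and>
     (\<forall>F c. finite F \<longrightarrow> F \<subseteq> X \<longrightarrow> 0 \<le> (\<Sum>x\<in>F. \<Sum>y\<in>F. c x * c y * k x y))"

lemma psd_kernelI:
  assumes "\<And>x y. x \<in> X \<Longrightarrow> y \<in> X \<Longrightarrow> k x y = k y x"
    and "\<And>F c. finite F \<Longrightarrow> F \<subseteq> X \<Longrightarrow> 0 \<le> (\<Sum>x\<in>F. \<Sum>y\<in>F. c x * c y * k x y)"
  shows "psd_kernel X k"
  using assms by (auto simp: psd_kernel_def)

lemma psd_kernel_sym: "psd_kernel X k \<Longrightarrow> x \<in> X \<Longrightarrow> y \<in> X \<Longrightarrow> k x y = k y x"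
  by (auto simp: psd_kernel_def)

lemma psd_kernel_nonneg:
  "psd_kernel X k \<Longrightarrow> finite F \<Longrightarrow> F \<subseteq> X \<Longrightarrow> 0 \<le> (\<Sum>x\<in>F. \<Sum>y\<in>F. c x * c y * k x y)"
  by (auto simp: psd_kernel_def)

lemma psd_kernel_diag_nonneg: "psd_kernel X k \<Longrightarrow> p \<in> X \<Longrightarrow> 0 \<le> k p p"
  using psd_kernel_nonneg[of X k "{p}" "\<lambda>_. 1"] by simp

lemma psd_kernel_cong:
  assumes "psd_kernel X k" "\<And>x y. x \<in> X \<Longrightarrow> y \<in> X \<Longrightarrow> k x y = k' x y"
  shows "psd_kernel X k'"
proof (rule psd_kernelI)
  fix x y assume "x \<in> X" "y \<in> X"
  then show "k' x y = k' y x" using assms psd_kernel_sym by metis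
next
  fix F and c :: "'a \<Rightarrow> real" assume F: "finite F" "F \<subseteq> X"
  have "(\<Sum>x\<in>F. \<Sum>y\<in>F. c x * c y * k x y) = (\<Sum>x\<in>F. \<Sum>y\<in>F. c x * c y * k' x y)"
    using F assms(2) by (intro sum.cong refl) (metis subsetD)
  with psd_kernel_nonneg[OF assms(1) F, of c]
  show "0 \<le> (\<Sum>x\<in>F. \<Sum>y\<in>F. c x * c y * k' x y)" by simp
qed

section \<open>Schur complements and Cholesky factorization\<close>

text \<open>This is the quadratic form at \<open>c\<close> plus \<open>t\<close> times the unit
  vector at \<open>p\<close>, kept as a polynomial in \<open>t\<close> so that suitable values can
  be inserted later. The point \<open>p\<close> may lie in \<open>F\<close>; then the coefficients
  add up.\<close>

lemma psd_kernel_border: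
  assumes k: "psd_kernel X k" and p: "p \<in> X" and F: "finite F" "F \<subseteq> X"
  shows "0 \<le> (\<Sum>x\<in>F. \<Sum>y\<in>F. c x * c y * k x y) + 2 * t * (\<Sum>x\<in>F. c x * k x p) + t\<^sup>2 * k p p"
proof -
  define F' where "F' = insert p F"
  \<comment> \<open>Both coefficient vectors are extended by zero to \<open>F'\<close>, which avoids
    a case distinction on \<open>p \<in> F\<close>.\<close>
  define u where "u x = (if x \<in> F then c x else 0)" for x
  define w where "w x = (if x = p then t else 0)" for x
  have F': "finite F'" "F' \<subseteq> X" "F \<subseteq> F'" "p \<in> F'" using p F by (auto simp: F'_def)
  have u: "(\<Sum>x\<in>F'. u x * g x) = (\<Sum>x\<in>F. c x * g x)" for g :: "'a \<Rightarrow> real"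
    using F' by (intro sum.mono_neutral_cong_right) (auto simp: u_def)
  have w: "(\<Sum>x\<in>F'. w x * g x) = t * g p" for g :: "'a \<Rightarrow> real"
  proof -
    have "(\<Sum>x\<in>F'. w x * g x) = (\<Sum>x\<in>F'. if x = p then t * g x else 0)"
      by (intro sum.cong) (auto simp: w_def)
    then show ?thesis using F' by (simp add: sum.delta)
  qed
  have inner: "(\<Sum>y\<in>F'. (u y + w y) * k x y) = (\<Sum>y\<in>F. c y * k x y) + t * k x p" for x
    by (simp add: ring_distribs sum.distrib u w)
  have "0 \<le> (\<Sum>x\<in>F'. \<Sum>y\<in>F'. (u x + w x) * (u y + w y) * k x y)"
    by (rule psd_kernel_nonneg[OF k F'(1,2)])
  also have "\<dots> = (\<Sum>x\<in>F'. (u x + w x) * ((\<Sum>y\<in>F. c y * k x y) + t * k x p))"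
    by (simp add: inner[symmetric] sum_distrib_left mult.assoc)
  also have "\<dots> = (\<Sum>x\<in>F. c x * ((\<Sum>y\<in>F. c y * k x y) + t * k x p))
                 + t * ((\<Sum>y\<in>F. c y * k p y) + t * k p p)"
    by (simp only: distrib_right[of "u _" "w _"] sum.distrib u w)
  also have "(\<Sum>y\<in>F. c y * k p y) = (\<Sum>x\<in>F. c x * k x p)"
    using psd_kernel_sym[OF k p] F by (intro sum.cong refl) auto
  finally show ?thesis
    by (simp add: ring_distribs sum.distrib sum_distrib_left power2_eq_square mult_ac)
qed

text \<open>With a vanishing diagonal entry the polynomial in \<open>psd_kernel_border\<close> is
  affine in \<open>t\<close>, and an affine function bounded below on the reals is constant.\<close>

lemma psd_kernel_row_zero:
  assumes k: "psd_kernel X k" and p: "p \<in> X" and x: "x \<in> X" and z: "k p p = 0"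
  shows "k x p = 0"
proof (rule ccontr)
  assume nz: "k x p \<noteq> 0"
  have "0 \<le> k x x + 2 * t * k x p" for t
    using psd_kernel_border[OF k p, of "{x}" "\<lambda>_. 1" t] x z by simp
  \<comment> \<open>This \<open>t\<close> makes the right-hand side equal to -1.\<close>
  from this[of "- (k x x + 1) / (2 * k x p)"] nz show False by (simp add: field_simps)
qed

text \<open>For \<open>k p p > 0\<close> the new form is the minimum over \<open>t\<close> of the
  polynomial in \<open>psd_kernel_border\<close>, attained at \<open>t = - b / k p p\<close>. If
  \<open>k p p = 0\<close>, the quotient is 0 by convention and the kernel does not change.\<close>

lemma psd_kernel_schur_complement:
  assumes k: "psd_kernel X k" and p: "p \<in> X"
  shows "psd_kernel X (\<lambda>x y. k x y - k x p * k y p / k p p)"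
proof (rule psd_kernelI)
  fix x y assume "x \<in> X" "y \<in> X"
  then show "k x y - k x p * k y p / k p p = k y x - k y p * k x p / k p p"
    using psd_kernel_sym[OF k] by (simp add: mult.commute)
next
  fix F and c :: "'a \<Rightarrow> real" assume F: "finite F" "F \<subseteq> X"
  define Q where "Q = (\<Sum>x\<in>F. \<Sum>y\<in>F. c x * c y * k x y)"
  define b where "b = (\<Sum>x\<in>F. c x * k x p)"
  have bb: "(\<Sum>x\<in>F. \<Sum>y\<in>F. c x * c y * (k x p * k y p / k p p)) = b\<^sup>2 / k p p"
    by (simp add: b_def power2_eq_square sum_product sum_divide_distrib mult_ac)
  have ge: "0 \<le> Q + 2 * t * b + t\<^sup>2 * k p p" for t
    using psd_kernel_border[OF k p F] by (simp add: Q_def b_def)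
  have "0 \<le> Q - b\<^sup>2 / k p p"
  proof (cases "k p p = 0")
    case True then show ?thesis using ge[of 0] by simp
  next
    case False
    then have "Q - b\<^sup>2 / k p p = Q + 2 * (- b / k p p) * b + (- b / k p p)\<^sup>2 * k p p"
      by (simp add: field_simps power2_eq_square)
    then show ?thesis using ge[of "- b / k p p"] by simp
  qed
  also have "\<dots> = (\<Sum>x\<in>F. \<Sum>y\<in>F. c x * c y * (k x y - k x p * k y p / k p p))"
    by (simp add: bb[symmetric] Q_def right_diff_distrib sum_subtractf)
  finally show "0 \<le> \<dots>" .
qed

text \<open>Symmetric Gaussian elimination along \<open>e\<close>. Points may repeat in
  \<open>e\<close> and pivots may vanish: a zero pivot makes the quotient 0, so that stage changes
  nothing.\<close>

primrec iterated_schur :: "('a \<Rightarrow> 'a \<Rightarrow> real) \<Rightarrow> (nat \<Rightarrow> 'a) \<Rightarrow> nat \<Rightarrow> 'a \<Rightarrow> 'a \<Rightarrow> real" where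
  "iterated_schur k e 0 = k"
| "iterated_schur k e (Suc m) =
     (\<lambda>x y. iterated_schur k e m x y
       - iterated_schur k e m x (e m) * iterated_schur k e m y (e m) / iterated_schur k e m (e m) (e m))"

lemma psd_kernel_iterated_schur:
  assumes "psd_kernel X k" "range e \<subseteq> X"
  shows "psd_kernel X (iterated_schur k e m)"
proof (induction m)
  case (Suc m)
  have "e m \<in> X" using assms by auto
  with psd_kernel_schur_complement[OF Suc] show ?case by simp
qed (use assms in simp)

text \<open>A row that is already zero stays zero, because the subtracted term has an entry of that
  row as a factor. The row of the current pivot cancels by symmetry or, for a zero pivot, vanishes
  already by \<open>psd_kernel_row_zero\<close>.\<close>

lemma iterated_schur_zero:
  assumes "psd_kernel X k" "range e \<subseteq> X" "y \<in> X" "j < m"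
  shows "iterated_schur k e m (e j) y = 0"
  using \<open>j < m\<close> \<open>y \<in> X\<close>
proof (induction m arbitrary: y)
  case (Suc m)
  let ?s = "iterated_schur k e m"
  have psd: "psd_kernel X ?s" by (rule psd_kernel_iterated_schur[OF assms(1,2)])
  have e: "e i \<in> X" for i using assms(2) by auto
  show ?case
  proof (cases "j = m")
    case False
    then have "j < m" using Suc.prems by simp
    then show ?thesis using Suc.IH[of y] Suc.IH[of "e m"] Suc.prems e by simp
  next
    case True
    have "?s (e m) y = ?s y (e m)" using psd_kernel_sym[OF psd] e Suc.prems by auto
    then show ?thesis
      using True psd_kernel_row_zero[OF psd e Suc.prems(2), of m]
      by (cases "?s (e m) (e m) = 0") auto
  qed
qed simp

text \<open>An infinite Cholesky factorization, obtained by taking Schur complements along an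
  enumeration: the point \<open>e j\<close> is annihilated from stage \<open>j + 1\<close> on.\<close>

lemma psd_kernel_factorization:
  assumes X: "countable X" and k: "psd_kernel X k"
  obtains L :: "'a \<Rightarrow> nat \<Rightarrow> real" and N :: "'a \<Rightarrow> nat"
  where "\<And>x j. x \<in> X \<Longrightarrow> N x \<le> j \<Longrightarrow> L x j = 0"
    and "\<And>x y m. x \<in> X \<Longrightarrow> y \<in> X \<Longrightarrow> N x \<le> m \<Longrightarrow> k x y = (\<Sum>j<m. L x j * L y j)"
proof (cases "X = {}")
  case True then show ?thesis using that by blast
next
  case False
  define e where "e = from_nat_into X"
  have e: "range e \<subseteq> X" unfolding e_def using False by (simp add: range_from_nat_into_subset)
  have em: "e m \<in> X" for m using e by auto
  define s where "s = iterated_schur k e"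
  define L where "L x j = s j x (e j) / sqrt (s j (e j) (e j))" for x j
  define N where "N x = Suc (to_nat_on X x)" for x
  have eN: "e (to_nat_on X x) = x" if "x \<in> X" for x
    using that X by (simp add: e_def)
  have psd: "psd_kernel X (s m)" for m
    unfolding s_def by (rule psd_kernel_iterated_schur[OF k e])
  have zero: "s m x y = 0" if "x \<in> X" "y \<in> X" "N x \<le> m" for x y m
    using iterated_schur_zero[OF k e that(2), of "to_nat_on X x" m] that eN
    by (simp add: N_def s_def)
  have LL: "L x j * L y j = s j x (e j) * s j y (e j) / s j (e j) (e j)" for x y j
    using psd_kernel_diag_nonneg[OF psd em, of j] by (simp add: L_def)
  \<comment> \<open>The product \<open>L x j * L y j\<close> is exactly what stage \<open>j\<close>
    subtracts, so the sum telescopes. The remainder vanishes as soon as \<open>x\<close> is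
    eliminated, whatever \<open>y\<close> is.\<close>
  have expand: "k x y = (\<Sum>j<m. L x j * L y j) + s m x y" for x y m
    by (induction m) (auto simp: s_def LL)
  show ?thesis
  proof (rule that[of N L])
    fix x j assume "x \<in> X" "N x \<le> j"
    then show "L x j = 0" using zero[OF _ em] by (simp add: L_def)
  next
    fix x y m assume "x \<in> X" "y \<in> X" "N x \<le> m"
    then show "k x y = (\<Sum>j<m. L x j * L y j)" using expand[of x y m] zero by simp
  qed
qed

section \<open>Closure properties of positive semidefinite kernels\<close>

lemma psd_kernel_const: "0 \<le> a \<Longrightarrow> psd_kernel X (\<lambda>x y. a)"
proof (rule psd_kernelI)
  fix F and c :: "'a \<Rightarrow> real" assume "0 \<le> a"
  have "(\<Sum>x\<in>F. \<Sum>y\<in>F. c x * c y * a) = a * (\<Sum>x\<in>F. c x)\<^sup>2"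
    by (simp add: power2_eq_square sum_product sum_distrib_left mult_ac)
  then show "0 \<le> (\<Sum>x\<in>F. \<Sum>y\<in>F. c x * c y * a)" using \<open>0 \<le> a\<close> by simp
qed simp

lemma psd_kernel_add:
  assumes "psd_kernel X k" "psd_kernel X l"
  shows "psd_kernel X (\<lambda>x y. k x y + l x y)"
proof (rule psd_kernelI)
  fix F and c :: "'a \<Rightarrow> real" assume F: "finite F" "F \<subseteq> X"
  show "0 \<le> (\<Sum>x\<in>F. \<Sum>y\<in>F. c x * c y * (k x y + l x y))"
    using psd_kernel_nonneg[OF assms(1) F, of c] psd_kernel_nonneg[OF assms(2) F, of c]
    by (simp add: distrib_left sum.distrib)
qed (simp add: assms[THEN psd_kernel_sym])

lemma psd_kernel_rescale:
  assumes "psd_kernel X k"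
  shows "psd_kernel X (\<lambda>x y. f x * f y * k x y)"
proof (rule psd_kernelI)
  fix F and c :: "'a \<Rightarrow> real" assume F: "finite F" "F \<subseteq> X"
  show "0 \<le> (\<Sum>x\<in>F. \<Sum>y\<in>F. c x * c y * (f x * f y * k x y))"
    using psd_kernel_nonneg[OF assms F, of "\<lambda>x. c x * f x"] by (simp add: mult_ac)
qed (simp add: psd_kernel_sym[OF assms] mult.commute)

text \<open>The Schur product theorem. On a finite set the factorization writes \<open>k\<close> as
  a finite sum of rank-one kernels, and multiplying \<open>l\<close> by a rank-one kernel only
  rescales it.\<close>

lemma psd_kernel_mult:
  assumes X: "countable X" and k: "psd_kernel X k" and l: "psd_kernel X l"
  shows "psd_kernel X (\<lambda>x y. k x y * l x y)"
proof (rule psd_kernelI)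
  fix F and c :: "'a \<Rightarrow> real" assume F: "finite F" "F \<subseteq> X"
  obtain L :: "'a \<Rightarrow> nat \<Rightarrow> real" and N
    where L: "\<And>x y m. x \<in> X \<Longrightarrow> y \<in> X \<Longrightarrow> N x \<le> m \<Longrightarrow> k x y = (\<Sum>j<m. L x j * L y j)"
    using psd_kernel_factorization[OF X k] by metis
  \<comment> \<open>A common length of the factorization for all points of \<open>F\<close>.\<close>
  define m where "m = (\<Sum>x\<in>F. N x)"
  have N: "N x \<le> m" if "x \<in> F" for x
    unfolding m_def using that F by (intro member_le_sum) auto
  have "0 \<le> (\<Sum>j<m. \<Sum>x\<in>F. \<Sum>y\<in>F. (c x * L x j) * (c y * L y j) * l x y)"
    by (intro sum_nonneg psd_kernel_nonneg[OF l F])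
  also have "\<dots> = (\<Sum>x\<in>F. \<Sum>y\<in>F. \<Sum>j<m. (c x * L x j) * (c y * L y j) * l x y)"
    by (subst sum.swap, rule sum.cong[OF refl], rule sum.swap)
  also have "\<dots> = (\<Sum>x\<in>F. \<Sum>y\<in>F. c x * c y * (k x y * l x y))"
  proof (intro sum.cong refl)
    fix x y assume "x \<in> F" "y \<in> F"
    then have "k x y = (\<Sum>j<m. L x j * L y j)" using L N F by blast
    then show "(\<Sum>j<m. (c x * L x j) * (c y * L y j) * l x y) = c x * c y * (k x y * l x y)"
      by (simp add: sum_distrib_left sum_distrib_right mult_ac)
  qed
  finally show "0 \<le> \<dots>" .
qed (simp add: psd_kernel_sym[OF k] psd_kernel_sym[OF l])

lemma psd_kernel_LIMSEQ:
  assumes k: "\<And>n. psd_kernel X (k n)"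
    and lim: "\<And>x y. x \<in> X \<Longrightarrow> y \<in> X \<Longrightarrow> (\<lambda>n. k n x y) \<longlonglongrightarrow> l x y"
  shows "psd_kernel X l"
proof (rule psd_kernelI)
  fix x y assume "x \<in> X" "y \<in> X"
  then show "l x y = l y x"
    using lim[of x y] lim[of y x] psd_kernel_sym[OF k, of x y] LIMSEQ_unique by fastforce
next
  fix F and c :: "'a \<Rightarrow> real" assume F: "finite F" "F \<subseteq> X"
  have "(\<lambda>n. \<Sum>x\<in>F. \<Sum>y\<in>F. c x * c y * k n x y) \<longlonglongrightarrow> (\<Sum>x\<in>F. \<Sum>y\<in>F. c x * c y * l x y)"
    using F lim by (intro tendsto_intros) auto
  then show "0 \<le> (\<Sum>x\<in>F. \<Sum>y\<in>F. c x * c y * l x y)"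
    by (rule LIMSEQ_le_const) (use psd_kernel_nonneg[OF k F] in blast)
qed

lemma psd_kernel_sum:
  assumes "\<And>i. i \<in> I \<Longrightarrow> psd_kernel X (k i)"
  shows "psd_kernel X (\<lambda>x y. \<Sum>i\<in>I. k i x y)"
  using assms
proof (induction I rule: infinite_finite_induct)
  case (insert i I)
  then have "psd_kernel X (\<lambda>x y. k i x y + (\<Sum>i\<in>I. k i x y))" by (intro psd_kernel_add) simp_all
  with insert show ?case by simp
qed (simp_all add: psd_kernel_const)

lemma psd_kernel_sums:
  assumes "\<And>n. psd_kernel X (k n)"
    and "\<And>x y. x \<in> X \<Longrightarrow> y \<in> X \<Longrightarrow> (\<lambda>n. k n x y) sums l x y"
  shows "psd_kernel X l"
proof (rule psd_kernel_LIMSEQ)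
  show "psd_kernel X (\<lambda>x y. \<Sum>n<m. k n x y)" for m by (rule psd_kernel_sum[OF assms(1)])
qed (use assms(2) in \<open>simp add: sums_def\<close>)

text \<open>Powers are covered by the Schur product theorem, and the exponential series has
  nonnegative coefficients.\<close>

lemma psd_kernel_exp:
  assumes X: "countable X" and k: "psd_kernel X k"
  shows "psd_kernel X (\<lambda>x y. exp (k x y))"
proof (rule psd_kernel_sums)
  have pow: "psd_kernel X (\<lambda>x y. k x y ^ n)" for n
  proof (induction n)
    case 0 show ?case using psd_kernel_const[of 1] by simp
  next
    case (Suc n) then show ?case using psd_kernel_mult[OF X k] by simp
  qed
  show "psd_kernel X (\<lambda>x y. k x y ^ n /\<^sub>R fact n)" for n
    using psd_kernel_mult[OF X psd_kernel_const[of "inverse (fact n)"] pow[of n]] by simp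
qed (rule exp_converges)

text \<open>For a Gram kernel this moves the origin to the vector of \<open>p\<close>. The new form
  at \<open>c\<close> is the old one after subtracting the total mass of \<open>c\<close> at
  \<open>p\<close>, that is, \<open>psd_kernel_border\<close> with \<open>t = - s\<close>.\<close>

lemma psd_kernel_recenter:
  assumes k: "psd_kernel X k" and p: "p \<in> X"
  shows "psd_kernel X (\<lambda>x y. k x y - k x p - k p y + k p p)"
proof (rule psd_kernelI)
  fix F and c :: "'a \<Rightarrow> real" assume F: "finite F" "F \<subseteq> X"
  define s where "s = (\<Sum>x\<in>F. c x)"
  have p': "(\<Sum>x\<in>F. c x * k p x) = (\<Sum>x\<in>F. c x * k x p)"
    using psd_kernel_sym[OF k p] F by (intro sum.cong refl) auto
  have "0 \<le> (\<Sum>x\<in>F. \<Sum>y\<in>F. c x * c y * k x y) + 2 * (- s) * (\<Sum>x\<in>F. c x * k x p) + (- s)\<^sup>2 * k p p"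
    by (rule psd_kernel_border[OF k p F])
  also have "\<dots> = (\<Sum>x\<in>F. \<Sum>y\<in>F. c x * c y * k x y) - (\<Sum>x\<in>F. c x * k x p) * s
      - s * (\<Sum>x\<in>F. c x * k p x) + s * s * k p p"
    by (simp add: p' power2_eq_square)
  also have "\<dots> = (\<Sum>x\<in>F. \<Sum>y\<in>F. c x * c y * (k x y - k x p - k p y + k p p))"
    unfolding s_def sum_product
    by (simp add: ring_distribs sum.distrib sum_subtractf sum_distrib_left sum_distrib_right mult_ac)
  finally show "0 \<le> \<dots>" .
qed (use psd_kernel_sym[OF k] p in auto)

text \<open>Each index \<open>a\<close> contributes a kernel on the points whose set contains
  \<open>a\<close>, extended by zero to all of \<open>X\<close>. For a finite \<open>F\<close> only
  the finitely many indices in the union of its sets matter.\<close>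

lemma psd_kernel_overlap:
  assumes fin: "\<And>x. x \<in> X \<Longrightarrow> finite (A x)"
    and psd: "\<And>a. psd_kernel {x \<in> X. a \<in> A x} (E a)"
  shows "psd_kernel X (\<lambda>x y. \<Sum>a\<in>A x \<inter> A y. E a x y)"
proof (rule psd_kernelI)
  fix x y assume "x \<in> X" "y \<in> X"
  then show "(\<Sum>a\<in>A x \<inter> A y. E a x y) = (\<Sum>a\<in>A y \<inter> A x. E a y x)"
    by (intro sum.cong) (auto intro: psd_kernel_sym[OF psd])
next
  fix F and c :: "'a \<Rightarrow> real" assume F: "finite F" "F \<subseteq> X"
  define B where "B = (\<Union>x\<in>F. A x)"
  have B: "finite B" unfolding B_def using F fin by auto
  have "0 \<le> (\<Sum>a\<in>B. \<Sum>x\<in>{x \<in> F. a \<in> A x}. \<Sum>y\<in>{x \<in> F. a \<in> A x}. c x * c y * E a x y)"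
    using F by (intro sum_nonneg psd_kernel_nonneg[OF psd]) auto
  also have "\<dots> = (\<Sum>a\<in>B. \<Sum>x\<in>F. \<Sum>y\<in>F. if a \<in> A x \<inter> A y then c x * c y * E a x y else 0)"
    using F(1) by (auto intro!: sum.cong simp: sum.inter_filter)
  also have "\<dots> = (\<Sum>x\<in>F. \<Sum>y\<in>F. \<Sum>a\<in>B. if a \<in> A x \<inter> A y then c x * c y * E a x y else 0)"
    by (subst sum.swap, rule sum.cong[OF refl], rule sum.swap)
  also have "\<dots> = (\<Sum>x\<in>F. \<Sum>y\<in>F. c x * c y * (\<Sum>a\<in>A x \<inter> A y. E a x y))"
  proof (intro sum.cong refl)
    fix x y assume "x \<in> F" "y \<in> F"
    then have "B \<inter> (A x \<inter> A y) = A x \<inter> A y" by (auto simp: B_def)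
    then show "(\<Sum>a\<in>B. if a \<in> A x \<inter> A y then c x * c y * E a x y else 0)
        = c x * c y * (\<Sum>a\<in>A x \<inter> A y. E a x y)"
      using sum.inter_restrict[OF B, of "\<lambda>a. c x * c y * E a x y" "A x \<inter> A y"]
      by (simp add: sum_distrib_left)
  qed
  finally show "0 \<le> \<dots>" .
qed

section \<open>Square-summable sequences\<close>

definition ell2 :: "(nat \<Rightarrow>\<^sub>C real) set" where
  "ell2 = {f. summable (\<lambda>n. (apply_bcontfun f n)\<^sup>2)}"

text \<open>The value 0 for divergent series matters: the locale for metric spaces demands a nonnegative
  distance on the whole type, not only on the carrier.\<close>

definition ell2_inner :: "(nat \<Rightarrow>\<^sub>C real) \<Rightarrow> (nat \<Rightarrow>\<^sub>C real) \<Rightarrow> real" where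
  "ell2_inner f g =
     (if summable (\<lambda>n. apply_bcontfun f n * apply_bcontfun g n)
      then (\<Sum>n. apply_bcontfun f n * apply_bcontfun g n) else 0)"

lemma summable_mult_of_squares:
  fixes a b :: "nat \<Rightarrow> real"
  assumes "summable (\<lambda>n. (a n)\<^sup>2)" "summable (\<lambda>n. (b n)\<^sup>2)"
  shows "summable (\<lambda>n. a n * b n)"
proof (rule summable_comparison_test_ev)
  show "summable (\<lambda>n. (a n)\<^sup>2 + (b n)\<^sup>2)" using assms by (rule summable_add)
  have "\<bar>a n * b n\<bar> \<le> (a n)\<^sup>2 + (b n)\<^sup>2" for n
    using sum_squares_bound[of "\<bar>a n\<bar>" "\<bar>b n\<bar>"] abs_ge_zero[of "a n * b n"]
    unfolding abs_mult power2_abs by linarith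
  then show "\<forall>\<^sub>F n in sequentially. norm (a n * b n) \<le> (a n)\<^sup>2 + (b n)\<^sup>2" by simp
qed

lemma summable_square_add:
  fixes a b :: "nat \<Rightarrow> real"
  assumes "summable (\<lambda>n. (a n)\<^sup>2)" "summable (\<lambda>n. (b n)\<^sup>2)"
  shows "summable (\<lambda>n. (a n + b n)\<^sup>2)"
  using summable_mult_of_squares[OF assms] assms
  by (simp add: power2_sum summable_add summable_mult mult.assoc)

text \<open>Square-summable sequences are bounded, so cutting \<open>ell2\<close> out of the bounded
  sequences loses none of them.\<close>

lemma ex_ell2_sequence:
  assumes "summable (\<lambda>n. (a n)\<^sup>2)"
  shows "\<exists>f\<in>ell2. apply_bcontfun f = a"
proof -
  obtain B where B: "\<And>n. norm ((a n)\<^sup>2) \<le> B"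
    using summable_imp_bounded[OF assms] by (auto simp: bounded_iff)
  have "norm (a n) \<le> sqrt B" for n using B[of n] by (simp add: real_le_rsqrt)
  then have "a \<in> bcontfun" by (intro bcontfun_normI) auto
  then have "apply_bcontfun (Bcontfun a) = a" by (rule Bcontfun_inverse)
  then show ?thesis using assms by (intro bexI[of _ "Bcontfun a"]) (auto simp: ell2_def)
qed

lemma subspace_ell2: "subspace ell2"
proof (rule subspaceI)
  fix f g assume "f \<in> ell2" "g \<in> ell2"
  then show "f + g \<in> ell2"
    using summable_square_add by (simp add: ell2_def plus_bcontfun.rep_eq)
qed (auto simp: ell2_def zero_bcontfun.rep_eq scaleR_bcontfun.rep_eq power_mult_distrib summable_mult)

lemma summable_ell2_inner:
  "f \<in> ell2 \<Longrightarrow> g \<in> ell2 \<Longrightarrow> summable (\<lambda>n. apply_bcontfun f n * apply_bcontfun g n)"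
  by (simp add: ell2_def summable_mult_of_squares)

lemma ell2_inner_eq:
  "f \<in> ell2 \<Longrightarrow> g \<in> ell2 \<Longrightarrow>
   ell2_inner f g = (\<Sum>n. apply_bcontfun f n * apply_bcontfun g n)"
  by (simp add: ell2_inner_def summable_ell2_inner)

lemma ell2_inner_nonneg: "0 \<le> ell2_inner f f"
  by (simp add: ell2_inner_def suminf_nonneg)

text \<open>Inequalities for finite sections, such as Minkowski's, pass to the norm through this
  limit.\<close>

lemma ell2_norm_limit:
  assumes "f \<in> ell2"
  shows "(\<lambda>m. L2_set (apply_bcontfun f) {..<m}) \<longlonglongrightarrow> ip_norm ell2_inner f"
proof -
  have "(\<lambda>m. \<Sum>n<m. (apply_bcontfun f n)\<^sup>2) \<longlonglongrightarrow> (\<Sum>n. (apply_bcontfun f n)\<^sup>2)"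
    using assms by (intro summable_LIMSEQ) (simp add: ell2_def)
  from tendsto_real_sqrt[OF this] show ?thesis
    by (simp add: L2_set_def ip_norm_def ell2_inner_eq[OF assms assms] power2_eq_square)
qed

lemma L2_set_le_ell2_norm:
  assumes "f \<in> ell2"
  shows "L2_set (apply_bcontfun f) {..<m} \<le> ip_norm ell2_inner f"
proof (rule LIMSEQ_le_const[OF ell2_norm_limit[OF assms]])
  show "\<exists>N. \<forall>n\<ge>N. L2_set (apply_bcontfun f) {..<m} \<le> L2_set (apply_bcontfun f) {..<n}"
    by (intro exI[of _ m]) (auto simp: L2_set_def intro!: sum_mono2)
qed

lemma ell2_norm_triangle:
  assumes "f \<in> ell2" "g \<in> ell2"
  shows "ip_norm ell2_inner (f + g) \<le> ip_norm ell2_inner f + ip_norm ell2_inner g"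
proof (rule LIMSEQ_le[OF ell2_norm_limit tendsto_add[OF ell2_norm_limit ell2_norm_limit]])
  show "f + g \<in> ell2" using assms subspace_ell2 subspace_add by blast
qed (use assms L2_set_triangle_ineq in \<open>auto simp: plus_bcontfun.rep_eq\<close>)

lemma ell2_inner_eq_0:
  assumes "f \<in> ell2" "ell2_inner f f = 0"
  shows "f = 0"
proof (rule bcontfun_eqI)
  fix n
  have "\<forall>n. apply_bcontfun f n * apply_bcontfun f n = 0"
    using assms suminf_eq_zero_iff[OF summable_ell2_inner[OF assms(1,1)]]
    by (simp add: ell2_inner_eq)
  then show "apply_bcontfun f n = apply_bcontfun 0 n" by (simp add: zero_bcontfun.rep_eq)
qed

lemma Metric_space_ell2: "Metric_space ell2 (\<lambda>f g. ip_norm ell2_inner (f - g))"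
proof
  fix f g h
  show "0 \<le> ip_norm ell2_inner (f - g)"
    by (simp add: ip_norm_def ell2_inner_nonneg)
  have "ell2_inner (- f) (- f) = ell2_inner f f" for f
    by (simp add: ell2_inner_def uminus_bcontfun.rep_eq)
  from this[of "f - g"] show "ip_norm ell2_inner (f - g) = ip_norm ell2_inner (g - f)"
    by (simp add: ip_norm_def)
  assume fg: "f \<in> ell2" "g \<in> ell2"
  then have d: "f - g \<in> ell2" using subspace_ell2 subspace_diff by blast
  have "ell2_inner 0 0 = 0" by (simp add: ell2_inner_def zero_bcontfun.rep_eq)
  then show "(ip_norm ell2_inner (f - g) = 0) = (f = g)"
    using ell2_inner_eq_0[OF d] by (auto simp: ip_norm_def)
  assume "h \<in> ell2"
  then have "g - h \<in> ell2" using fg subspace_ell2 subspace_diff by blast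
  then show "ip_norm ell2_inner (f - h) \<le> ip_norm ell2_inner (f - g) + ip_norm ell2_inner (g - h)"
    using ell2_norm_triangle[OF d, of "g - h"] by simp
qed

text \<open>The limit is taken coordinatewise. Cauchy estimates are stated for finite sections with
  a threshold independent of the length \<open>m\<close>; for fixed \<open>m\<close> one lets
  \<open>j\<close> tend to infinity in a finite sum, and only then lets \<open>m\<close>
  grow.\<close>

lemma mcomplete_ell2: "Metric_space.mcomplete ell2 (\<lambda>f g. ip_norm ell2_inner (f - g))"
proof -
  interpret Metric_space ell2 "\<lambda>f g. ip_norm ell2_inner (f - g)" by (rule Metric_space_ell2)
  have "\<exists>g. limitin mtopology \<sigma> g sequentially" if "MCauchy \<sigma>" for \<sigma>
  proof -
    define s where "s i = apply_bcontfun (\<sigma> i)" for i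
    have \<sigma>: "\<sigma> i \<in> ell2" for i using that by (auto simp: MCauchy_def)
    have \<sigma>d: "\<sigma> i - \<sigma> j \<in> ell2" for i j using \<sigma> subspace_ell2 subspace_diff by blast
    have cauchy: "\<exists>N. \<forall>i j. N \<le> i \<longrightarrow> N \<le> j \<longrightarrow> (\<forall>m. L2_set (\<lambda>n. s i n - s j n) {..<m} < e)"
      if e: "0 < e" for e
    proof -
      obtain N where N: "\<And>i j. N \<le> i \<Longrightarrow> N \<le> j \<Longrightarrow> ip_norm ell2_inner (\<sigma> i - \<sigma> j) < e"
        using \<open>MCauchy \<sigma>\<close> \<open>0 < e\<close> unfolding MCauchy_def by blast
      have "L2_set (\<lambda>n. s i n - s j n) {..<m} < e" if "N \<le> i" "N \<le> j" for i j m
        using L2_set_le_ell2_norm[OF \<sigma>d, of i j m] N[OF that]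
        by (simp add: s_def minus_bcontfun.rep_eq)
      then show ?thesis by blast
    qed
    have "Cauchy (\<lambda>i. s i n)" for n
    proof (rule CauchyI)
      fix e :: real assume "0 < e"
      then obtain N where N: "\<And>i j m. N \<le> i \<Longrightarrow> N \<le> j \<Longrightarrow> L2_set (\<lambda>n. s i n - s j n) {..<m} < e"
        using cauchy by blast
      have "norm (s i n - s j n) < e" if "N \<le> i" "N \<le> j" for i j
      proof -
        have "\<bar>s i n - s j n\<bar> \<le> L2_set (\<lambda>n. \<bar>s i n - s j n\<bar>) {..<Suc n}"
          by (rule member_le_L2_set) auto
        then show ?thesis using N[OF that, of "Suc n"] by (simp add: L2_set_def)
      qed
      then show "\<exists>N. \<forall>i\<ge>N. \<forall>j\<ge>N. norm (s i n - s j n) < e" by blast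
    qed
    then have "\<exists>l. (\<lambda>i. s i n) \<longlonglongrightarrow> l" for n
      by (simp add: Cauchy_convergent_iff convergent_def)
    then obtain a where a: "\<And>n. (\<lambda>i. s i n) \<longlonglongrightarrow> a n" by metis
    have close: "\<exists>N. \<forall>i\<ge>N. \<forall>m. L2_set (\<lambda>n. s i n - a n) {..<m} \<le> e" if e: "0 < e" for e
    proof -
      obtain N where N: "\<And>i j m. N \<le> i \<Longrightarrow> N \<le> j \<Longrightarrow> L2_set (\<lambda>n. s i n - s j n) {..<m} < e"
        using cauchy[OF e] by blast
      have "L2_set (\<lambda>n. s i n - a n) {..<m} \<le> e" if "N \<le> i" for i m
      proof (rule LIMSEQ_le_const2)
        show "(\<lambda>j. L2_set (\<lambda>n. s i n - s j n) {..<m}) \<longlonglongrightarrow> L2_set (\<lambda>n. s i n - a n) {..<m}"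
          unfolding L2_set_def by (intro tendsto_intros a)
        show "\<exists>N. \<forall>j\<ge>N. L2_set (\<lambda>n. s i n - s j n) {..<m} \<le> e"
          using N[OF that] by (meson less_imp_le)
      qed
      then show ?thesis by blast
    qed
    have sq: "summable (\<lambda>n. (s i n - a n)\<^sup>2)"
      if "\<And>m. L2_set (\<lambda>n. s i n - a n) {..<m} \<le> e" for i e
    proof (rule bounded_imp_summable)
      fix m
      have "sqrt (\<Sum>n<Suc m. (s i n - a n)\<^sup>2) \<le> e" using that[of "Suc m"] by (simp add: L2_set_def)
      then show "(\<Sum>n\<le>m. (s i n - a n)\<^sup>2) \<le> e\<^sup>2"
        unfolding lessThan_Suc_atMost by (rule sqrt_le_D)
    qed simp
    obtain N where N: "\<And>m. L2_set (\<lambda>n. s N n - a n) {..<m} \<le> 1"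
      using close[of 1] by auto
    \<comment> \<open>The sequence \<open>a\<close> is written as a sum of two square-summable ones:
      its difference from \<open>s N\<close>, controlled by \<open>close\<close>, and
      \<open>s N\<close> itself.\<close>
    have "summable (\<lambda>n. (- (s N n - a n) + s N n)\<^sup>2)"
      using sq[OF N] \<sigma>[of N]
      by (intro summable_square_add) (simp_all add: ell2_def s_def power2_commute)
    then have "summable (\<lambda>n. (a n)\<^sup>2)" by simp
    then obtain g where g: "g \<in> ell2" "apply_bcontfun g = a"
      using ex_ell2_sequence by blast
    have "limitin mtopology \<sigma> g sequentially"
      unfolding limitin_metric
    proof (intro conjI allI impI)
      fix e :: real assume "0 < e"
      then obtain N where N: "\<And>i m. N \<le> i \<Longrightarrow> L2_set (\<lambda>n. s i n - a n) {..<m} \<le> e / 2"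
        using close[of "e / 2"] by auto
      have "ip_norm ell2_inner (\<sigma> i - g) < e" if "N \<le> i" for i
      proof -
        have "\<sigma> i - g \<in> ell2" using \<sigma> g subspace_ell2 subspace_diff by blast
        from ell2_norm_limit[OF this] have "ip_norm ell2_inner (\<sigma> i - g) \<le> e / 2"
          by (rule LIMSEQ_le_const2)
            (use N[OF that] g in \<open>auto simp: s_def minus_bcontfun.rep_eq\<close>)
        then show ?thesis using \<open>0 < e\<close> by simp
      qed
      then show "\<forall>\<^sub>F i in sequentially. \<sigma> i \<in> ell2 \<and> ip_norm ell2_inner (\<sigma> i - g) < e"
        using \<sigma> by (auto simp: eventually_sequentially)
    qed (rule g)
    then show ?thesis by blast
  qed
  then show ?thesis by (simp add: mcomplete_def)
qed

lemma hilbert_space_on_ell2: "hilbert_space_on ell2 ell2_inner"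
  unfolding hilbert_space_on_def
proof (intro conjI ballI allI impI)
  fix f g h c assume f: "f \<in> ell2" and g: "g \<in> ell2"
  show "ell2_inner f g = ell2_inner g f" by (simp add: ell2_inner_def mult.commute)
  have "c *\<^sub>R f \<in> ell2" using f subspace_ell2 subspace_scale by blast
  then show "ell2_inner (c *\<^sub>R f) g = c * ell2_inner f g"
    using f g suminf_mult[OF summable_ell2_inner[OF f g], of c]
    by (simp add: ell2_inner_eq scaleR_bcontfun.rep_eq mult.assoc)
  assume h: "h \<in> ell2"
  have "f + g \<in> ell2" using f g subspace_ell2 subspace_add by blast
  then show "ell2_inner (f + g) h = ell2_inner f h + ell2_inner g h"
    using f g h suminf_add[OF summable_ell2_inner[OF f h] summable_ell2_inner[OF g h]]
    by (simp add: ell2_inner_eq plus_bcontfun.rep_eq distrib_right)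
qed (auto simp: subspace_ell2 ell2_inner_nonneg mcomplete_ell2 dest: ell2_inner_eq_0)

section \<open>Gaussian kernels and their averages over overlaps\<close>

lemma hilbert_space_onD [rule_format]:
  assumes "hilbert_space_on V ip"
  shows "subspace V"
    and "\<forall>x\<in>V. \<forall>y\<in>V. ip x y = ip y x"
    and "\<forall>x\<in>V. \<forall>y\<in>V. \<forall>z\<in>V. ip (x + y) z = ip x z + ip y z"
    and "\<forall>c. \<forall>x\<in>V. \<forall>y\<in>V. ip (c *\<^sub>R x) y = c * ip x y"
    and "\<forall>x\<in>V. 0 \<le> ip x x"
  using assms unfolding hilbert_space_on_def by - (elim conjE, assumption)+

lemma ip_sum_left:
  assumes H: "hilbert_space_on V ip" and u: "\<And>x. x \<in> F \<Longrightarrow> u x \<in> V" and z: "z \<in> V"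
  shows "ip (\<Sum>x\<in>F. c x *\<^sub>R u x) z = (\<Sum>x\<in>F. c x * ip (u x) z)"
proof -
  have ip0: "ip 0 z = 0" using hilbert_space_onD(4)[OF H z z, of 0] by simp
  show ?thesis using u
  proof (induction F rule: infinite_finite_induct)
    case (insert x F)
    have "c x *\<^sub>R u x \<in> V" "(\<Sum>x\<in>F. c x *\<^sub>R u x) \<in> V"
      using insert.prems hilbert_space_onD(1)[OF H] by (auto intro!: subspace_scale subspace_sum)
    then show ?case
      using insert hilbert_space_onD(3)[OF H _ _ z] hilbert_space_onD(4)[OF H _ z] by simp
  qed (simp_all add: ip0)
qed

lemma psd_kernel_gram:
  fixes u :: "'a \<Rightarrow> 'v::real_vector"
  assumes H: "hilbert_space_on V ip" and u: "u ` X \<subseteq> V"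
  shows "psd_kernel X (\<lambda>x y. ip (u x) (u y))"
proof (rule psd_kernelI)
  fix x y assume "x \<in> X" "y \<in> X"
  then show "ip (u x) (u y) = ip (u y) (u x)" using hilbert_space_onD(2)[OF H] u by auto
next
  fix F and c :: "'a \<Rightarrow> real" assume F: "finite F" "F \<subseteq> X"
  define v where "v = (\<Sum>x\<in>F. c x *\<^sub>R u x)"
  have uV: "u x \<in> V" if "x \<in> F" for x using that F u by auto
  have v: "v \<in> V"
    unfolding v_def using uV hilbert_space_onD(1)[OF H] by (auto intro!: subspace_scale subspace_sum)
  have "0 \<le> ip v v" using hilbert_space_onD(5)[OF H v] .
  also have "\<dots> = (\<Sum>x\<in>F. c x * ip (u x) v)"
    using ip_sum_left[OF H _ v, of F u c] uV by (simp add: v_def)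
  also have "\<dots> = (\<Sum>x\<in>F. c x * ip v (u x))"
    using hilbert_space_onD(2)[OF H v] uV by (intro sum.cong refl) auto
  also have "\<dots> = (\<Sum>x\<in>F. c x * (\<Sum>y\<in>F. c y * ip (u y) (u x)))"
    using ip_sum_left[OF H, of F u _ c] uV by (intro sum.cong refl) (simp add: v_def)
  also have "\<dots> = (\<Sum>x\<in>F. \<Sum>y\<in>F. c x * c y * ip (u x) (u y))"
  proof -
    have "ip (u y) (u x) = ip (u x) (u y)" if "x \<in> F" "y \<in> F" for x y
      using hilbert_space_onD(2)[OF H] uV that by blast
    then show ?thesis by (auto intro!: sum.cong simp: sum_distrib_left)
  qed
  finally show "0 \<le> \<dots>" .
qed

lemma ip_norm_diff_square:
  assumes H: "hilbert_space_on V ip" and v: "v \<in> V" and w: "w \<in> V"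
  shows "(ip_norm ip (v - w))\<^sup>2 = ip v v + ip w w - 2 * ip v w"
proof -
  note V = hilbert_space_onD(1)[OF H] and lin = hilbert_space_onD(2-)[OF H]
  have mw: "(- 1) *\<^sub>R w \<in> V" using V w by (rule subspace_scale)
  have d: "v - w \<in> V" using V v w by (rule subspace_diff)
  have diff: "ip (v - w) z = ip v z - ip w z" if "z \<in> V" for z
    using lin(2)[OF v mw that] lin(3)[OF w that, of "- 1"] by simp
  have "(ip_norm ip (v - w))\<^sup>2 = ip (v - w) (v - w)"
    using lin(4)[OF d] by (simp add: ip_norm_def)
  also have "\<dots> = ip (v - w) v - ip (v - w) w"
    using diff[OF d] lin(1)[OF v d] lin(1)[OF w d] by simp
  finally show ?thesis using diff[OF v] diff[OF w] lin(1)[OF v w] by simp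
qed

lemma ip_norm_diff_nonneg:
  assumes H: "hilbert_space_on V ip" and "v \<in> V" "w \<in> V"
  shows "0 \<le> ip_norm ip (v - w)"
  using hilbert_space_onD(5)[OF H subspace_diff[OF hilbert_space_onD(1)[OF H] assms(2,3)]]
  by (simp add: ip_norm_def)

text \<open>Expanding the square splits the Gaussian into \<open>f x * f y\<close> times the
  exponential of a multiple of the Gram kernel.\<close>

lemma psd_kernel_gaussian:
  assumes X: "countable X" and H: "hilbert_space_on V ip" and u: "u ` X \<subseteq> V" and t: "0 \<le> t"
  shows "psd_kernel X (\<lambda>x y. exp (- t * (ip_norm ip (u x - u y))\<^sup>2))"
proof -
  define f where "f x = exp (- t * ip (u x) (u x))" for x
  have "psd_kernel X (\<lambda>x y. 2 * t * ip (u x) (u y))"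
    using psd_kernel_mult[OF X psd_kernel_const psd_kernel_gram[OF H u], of "2 * t"] t by simp
  from psd_kernel_rescale[OF psd_kernel_exp[OF X this], of f]
  show ?thesis
  proof (rule psd_kernel_cong)
    fix x y assume "x \<in> X" "y \<in> X"
    then have "u x \<in> V" "u y \<in> V" using u by auto
    then show "f x * f y * exp (2 * t * ip (u x) (u y)) = exp (- t * (ip_norm ip (u x - u y))\<^sup>2)"
      by (simp add: ip_norm_diff_square[OF H] f_def exp_add[symmetric] algebra_simps)
  qed
qed

text \<open>The upper bound rests on \<open>card (A \<inter> B)\<close> being at most the geometric
  mean of the two cardinalities. For the lower bound, the overlap and the values \<open>e a\<close>
  each cost a factor \<open>1 - \<epsilon>\<close>.\<close>

lemma normalized_overlap_bounds:
  fixes e :: "'b \<Rightarrow> real"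
  assumes A: "finite A" "A \<noteq> {}" and B: "finite B" "B \<noteq> {}"
  defines "r \<equiv> 1 / sqrt (card A) * (1 / sqrt (card B)) * (\<Sum>a\<in>A \<inter> B. e a)"
  shows "\<lbrakk>\<And>a. a \<in> A \<inter> B \<Longrightarrow> e a \<le> \<eta>; 0 \<le> \<eta>\<rbrakk> \<Longrightarrow> r \<le> \<eta>"
    and "\<lbrakk>\<And>a. a \<in> A \<inter> B \<Longrightarrow> 1 - \<epsilon> \<le> e a; \<epsilon> \<le> 1;
          card (sym_diff A B) / card A < \<epsilon>; card (sym_diff B A) / card B < \<epsilon>\<rbrakk>
         \<Longrightarrow> 1 - 2 * \<epsilon> \<le> r"
proof -
  define s where "s = sqrt (card A) * sqrt (card B)"
  have pos: "0 < real (card A)" "0 < real (card B)" using A B by (auto simp: card_gt_0_iff)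
  then have s: "0 < s" by (simp add: s_def)
  have r: "r = (\<Sum>a\<in>A \<inter> B. e a) / s" by (simp add: r_def s_def)
  have le: "card (A \<inter> B) \<le> s"
  proof -
    have "real (card (A \<inter> B)) \<le> card A" "real (card (A \<inter> B)) \<le> card B"
      using A B by (simp_all add: card_mono)
    then have "sqrt (card (A \<inter> B)) * sqrt (card (A \<inter> B)) \<le> s"
      unfolding s_def by (intro mult_mono) auto
    then show ?thesis by simp
  qed
  {
    assume "\<And>a. a \<in> A \<inter> B \<Longrightarrow> e a \<le> \<eta>" "0 \<le> \<eta>"
    then have "(\<Sum>a\<in>A \<inter> B. e a) \<le> card (A \<inter> B) * \<eta>" by (intro sum_bounded_above) auto
    also have "\<dots> \<le> s * \<eta>" using le \<open>0 \<le> \<eta>\<close> by (rule mult_right_mono)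
    finally show "r \<le> \<eta>" using s by (simp add: r field_simps)
  }
  assume e: "\<And>a. a \<in> A \<inter> B \<Longrightarrow> 1 - \<epsilon> \<le> e a" and \<epsilon>: "\<epsilon> \<le> 1"
    and close: "card (sym_diff A B) / card A < \<epsilon>" "card (sym_diff B A) / card B < \<epsilon>"
  \<comment> \<open>Stated for arbitrary sets because it is applied in both orders. The part of
    \<open>A\<close> outside \<open>B\<close> lies in the symmetric difference.\<close>
  have ge: "(1 - \<epsilon>) * card A \<le> card (A \<inter> B)"
    if "card (sym_diff A B) / card A < \<epsilon>" "finite A" "finite B" "0 < real (card A)" for A B :: "'b set"
  proof -
    have "card A = card (A \<inter> B) + card (A - B)"
      using that card_Un_disjoint[of "A \<inter> B" "A - B"] by (simp add: Int_Diff_Un Int_Diff_disjoint)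
    moreover have "card (A - B) \<le> card (sym_diff A B)" using that by (intro card_mono) auto
    moreover have "card (sym_diff A B) < \<epsilon> * card A" using that by (simp add: field_simps)
    ultimately show ?thesis by (simp add: algebra_simps)
  qed
  \<comment> \<open>The geometric mean of the two lower bounds for
    \<open>card (A \<inter> B)\<close>.\<close>
  have "sqrt ((1 - \<epsilon>) * card A) * sqrt ((1 - \<epsilon>) * card B) \<le> sqrt (card (A \<inter> B)) * sqrt (card (A \<inter> B))"
    using ge[OF close(1) A(1) B(1) pos(1)] ge[OF close(2) B(1) A(1) pos(2)] \<epsilon>
    by (intro mult_mono) (auto simp: Int_commute)
  also have "sqrt ((1 - \<epsilon>) * card A) * sqrt ((1 - \<epsilon>) * card B) = (1 - \<epsilon>) * s"
    using \<epsilon> by (simp add: s_def real_sqrt_mult mult_ac)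
  finally have "(1 - \<epsilon>) * s \<le> card (A \<inter> B)" by simp
  then have "(1 - \<epsilon>) * s * (1 - \<epsilon>) \<le> card (A \<inter> B) * (1 - \<epsilon>)"
    using \<epsilon> by (intro mult_right_mono) auto
  also have "\<dots> \<le> (\<Sum>a\<in>A \<inter> B. e a)" using e by (intro sum_bounded_below)
  finally have "(1 - \<epsilon>) * (1 - \<epsilon>) \<le> r" using s by (simp add: r field_simps)
  moreover have "1 - 2 * \<epsilon> \<le> (1 - \<epsilon>) * (1 - \<epsilon>)" by (simp add: algebra_simps)
  ultimately show "1 - 2 * \<epsilon> \<le> r" by linarith
qed

text \<open>The normalization has the product form of \<open>psd_kernel_rescale\<close>, hence
  preserves positive semidefiniteness, and it makes the diagonal 1. One \<epsilon> of the error
  comes from the overlap, the other from the Gaussian factors.\<close>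

lemma ex_overlap_kernel:
  fixes A :: "'a \<Rightarrow> 'b set" and V :: "'b \<Rightarrow> 'v::real_vector set"
  assumes X: "countable X"
    and A: "\<And>x. x \<in> X \<Longrightarrow> finite (A x)" "\<And>x. x \<in> X \<Longrightarrow> A x \<noteq> {}"
    and H: "\<And>a x. x \<in> X \<Longrightarrow> a \<in> A x \<Longrightarrow> hilbert_space_on (V a) (ip a) \<and> u a x \<in> V a"
    and sym: "\<And>x y. x \<in> X \<Longrightarrow> y \<in> X \<Longrightarrow> d x y = d y x"
    and close: "\<And>x y. x \<in> X \<Longrightarrow> y \<in> X \<Longrightarrow> d x y < R \<Longrightarrow>
                  real (card (sym_diff (A x) (A y))) / real (card (A x)) < \<epsilon>"
    and near: "\<And>x y a. x \<in> X \<Longrightarrow> y \<in> X \<Longrightarrow> a \<in> A x \<inter> A y \<Longrightarrow> d x y < R \<Longrightarrow>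
                  (ip_norm (ip a) (u a x - u a y))\<^sup>2 \<le> B"
    and far: "\<And>M. \<exists>D. \<forall>x\<in>X. \<forall>y\<in>X. \<forall>a\<in>A x \<inter> A y. D \<le> d x y \<longrightarrow>
                  M \<le> (ip_norm (ip a) (u a x - u a y))\<^sup>2"
    and \<epsilon>: "0 < \<epsilon>" "\<epsilon> \<le> 1"
  shows "\<exists>k. psd_kernel X k \<and> (\<forall>x\<in>X. k x x = 1) \<and> (\<forall>x\<in>X. \<forall>y\<in>X. 0 \<le> k x y \<and> k x y \<le> 1) \<and>
             (\<forall>x\<in>X. \<forall>y\<in>X. d x y < R \<longrightarrow> 1 - 2 * \<epsilon> \<le> k x y) \<and>
             (\<exists>D. \<forall>x\<in>X. \<forall>y\<in>X. D \<le> d x y \<longrightarrow> k x y \<le> 1/2)"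
proof -
  \<comment> \<open>Chosen so that \<open>t\<close> is positive and
    \<open>t * B \<le> \<epsilon>\<close> for every real \<open>B\<close>; then
    \<open>exp (- s) \<ge> 1 - s\<close> bounds the Gaussians below by
    \<open>1 - \<epsilon>\<close>.\<close>
  define t where "t = \<epsilon> / (1 + \<bar>B\<bar>)"
  have t: "0 < t" "t * B \<le> \<epsilon>"
    using \<epsilon> by (auto simp: t_def field_simps abs_if)
  define E where "E a x y = exp (- t * (ip_norm (ip a) (u a x - u a y))\<^sup>2)" for a x y
  define k where "k x y = 1 / sqrt (card (A x)) * (1 / sqrt (card (A y))) * (\<Sum>a\<in>A x \<inter> A y. E a x y)" for x y
  have E: "0 \<le> E a x y" "E a x y \<le> 1" for a x y using t by (auto simp: E_def)
  have upper: "k x y \<le> \<eta>"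
    if "x \<in> X" "y \<in> X" "0 \<le> \<eta>" "\<And>a. a \<in> A x \<inter> A y \<Longrightarrow> E a x y \<le> \<eta>" for x y \<eta>
    unfolding k_def using that A by (intro normalized_overlap_bounds(1)) auto
  have "psd_kernel {x \<in> X. a \<in> A x} (E a)" for a
  \<comment> \<open>For an index in no set \<open>A x\<close>, nothing is known about
    \<open>V a\<close>.\<close>
  proof (cases "{x \<in> X. a \<in> A x} = {}")
    case True show ?thesis unfolding True by (simp add: psd_kernel_def)
  next
    case False
    then have "hilbert_space_on (V a) (ip a)" using H by blast
    moreover have "u a ` {x \<in> X. a \<in> A x} \<subseteq> V a" using H by blast
    ultimately show ?thesis
      unfolding E_def using X t by (intro psd_kernel_gaussian) auto
  qed
  then have "psd_kernel X k"
    unfolding k_def by (intro psd_kernel_rescale psd_kernel_overlap A(1))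
  moreover have "k x x = 1" if "x \<in> X" for x
  proof -
    have "E a x x = 1" if "a \<in> A x" for a
      using ip_norm_diff_square[of "V a" "ip a" "u a x" "u a x"] H[OF \<open>x \<in> X\<close> that]
      by (simp add: E_def)
    then show ?thesis using A[OF that] by (simp add: k_def)
  qed
  moreover have "0 \<le> k x y" for x y
    unfolding k_def using E by (intro mult_nonneg_nonneg sum_nonneg) auto
  moreover have "1 - 2 * \<epsilon> \<le> k x y" if "x \<in> X" "y \<in> X" "d x y < R" for x y
    unfolding k_def
  proof (rule normalized_overlap_bounds(2))
    fix a assume "a \<in> A x \<inter> A y"
    then have "t * (ip_norm (ip a) (u a x - u a y))\<^sup>2 \<le> t * B"
      using near[OF that(1,2) _ that(3)] t by (intro mult_left_mono) auto
    then show "1 - \<epsilon> \<le> E a x y"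
      using exp_ge_add_one_self[of "- t * (ip_norm (ip a) (u a x - u a y))\<^sup>2"] t(2)
      by (simp add: E_def)
  qed (use that sym A close \<epsilon> in auto)
  moreover have "\<exists>D. \<forall>x\<in>X. \<forall>y\<in>X. D \<le> d x y \<longrightarrow> k x y \<le> 1/2"
  proof -
    \<comment> \<open>From squared norm \<open>ln 2 / t\<close> on, every Gaussian factor is at most
      1/2, and so is their normalized sum.\<close>
    obtain D where D: "\<And>x y a. x \<in> X \<Longrightarrow> y \<in> X \<Longrightarrow> a \<in> A x \<inter> A y \<Longrightarrow> D \<le> d x y \<Longrightarrow>
        ln 2 / t \<le> (ip_norm (ip a) (u a x - u a y))\<^sup>2"
      using far[of "ln 2 / t"] by blast
    have "k x y \<le> 1/2" if "x \<in> X" "y \<in> X" "D \<le> d x y" for x y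
    proof (rule upper)
      fix a assume "a \<in> A x \<inter> A y"
      from D[OF that(1,2) this that(3)]
      have "- t * (ip_norm (ip a) (u a x - u a y))\<^sup>2 \<le> ln (1/2)"
        using t by (simp add: field_simps ln_div)
      then have "E a x y \<le> exp (ln (1/2))" unfolding E_def exp_le_cancel_iff .
      then show "E a x y \<le> 1/2" by simp
    qed (use that in auto)
    then show ?thesis by blast
  qed
  moreover have "k x y \<le> 1" if "x \<in> X" "y \<in> X" for x y
    using upper[OF that, of 1] E by simp
  ultimately show ?thesis by (intro exI[of _ k] conjI ballI impI) simp_all
qed

section \<open>Coarse embeddings from kernels\<close>

text \<open>The control functions are the infimum of the norms over pairs at distance at least
  \<open>r\<close> and the supremum over pairs at distance at most \<open>r\<close>, modified to be
  defined everywhere and to diverge.\<close>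

lemma coarsely_embeddableI:
  fixes V :: "'v::real_vector set" and d :: "'a \<Rightarrow> 'a \<Rightarrow> real"
  assumes H: "hilbert_space_on V ip" and \<phi>: "\<phi> ` X \<subseteq> V"
    and upper: "\<And>r. \<exists>B. \<forall>x\<in>X. \<forall>y\<in>X. d x y \<le> r \<longrightarrow> ip_norm ip (\<phi> x - \<phi> y) \<le> B"
    and lower: "\<And>M. \<exists>D. \<forall>x\<in>X. \<forall>y\<in>X. D \<le> d x y \<longrightarrow> M \<le> ip_norm ip (\<phi> x - \<phi> y)"
  shows "coarsely_embeddable TYPE('v) X d"
proof -
  define N where "N x y = ip_norm ip (\<phi> x - \<phi> y)" for x y
  \<comment> \<open>If no pair is far enough apart, the inserted \<open>r\<close> keeps the infimum
    meaningful and lets it diverge. The 0 in \<open>T r\<close> likewise guards the supremum against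
    an empty set.\<close>
  define S where "S r = insert r {N x y | x y. x \<in> X \<and> y \<in> X \<and> r \<le> d x y}" for r
  define T where "T r = insert 0 {N x y | x y. x \<in> X \<and> y \<in> X \<and> d x y \<le> r}" for r
  define \<rho>1 where "\<rho>1 r = Inf (S r)" for r
  \<comment> \<open>The summand \<open>max r 0\<close> forces divergence even if the norms stay
    bounded.\<close>
  define \<rho>2 where "\<rho>2 r = max r 0 + Sup (T r)" for r
  have N0: "0 \<le> N x y" if "x \<in> X" "y \<in> X" for x y
    unfolding N_def using \<phi> that by (intro ip_norm_diff_nonneg[OF H]) auto
  have S: "bdd_below (S r)" for r
    by (rule bdd_belowI[of _ "min r 0"]) (auto simp: S_def min_le_iff_disj dest: N0)
  have T: "bdd_above (T r)" for r
  proof -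
    obtain B where "\<forall>x\<in>X. \<forall>y\<in>X. d x y \<le> r \<longrightarrow> N x y \<le> B" using upper[of r] by (auto simp: N_def)
    then show ?thesis by (intro bdd_aboveI[of _ "max 0 B"]) (auto simp: T_def le_max_iff_disj)
  qed
  have T0: "0 \<le> Sup (T r)" for r by (rule cSup_upper[OF _ T]) (simp add: T_def)
  have "mono_on {0..} \<rho>1"
  proof (rule mono_onI)
    fix r s :: real assume "r \<le> s"
    show "\<rho>1 r \<le> \<rho>1 s" unfolding \<rho>1_def
    proof (rule cInf_mono)
      fix b assume "b \<in> S s"
      then have "b = s \<or> b \<in> S r" using \<open>r \<le> s\<close> by (force simp: S_def)
      then show "\<exists>a\<in>S r. a \<le> b"
      proof
        assume "b = s" then show ?thesis using \<open>r \<le> s\<close> by (intro bexI[of _ r]) (auto simp: S_def)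
      qed blast
    qed (use S in \<open>auto simp: S_def\<close>)
  qed
  moreover have "mono_on {0..} \<rho>2"
  proof (rule mono_onI)
    fix r s :: real assume "r \<le> s"
    moreover have "Sup (T r) \<le> Sup (T s)"
      by (rule cSup_subset_mono[OF _ T]) (use \<open>r \<le> s\<close> in \<open>force simp: T_def\<close>)+
    ultimately show "\<rho>2 r \<le> \<rho>2 s" by (simp add: \<rho>2_def)
  qed
  moreover have "filterlim \<rho>1 at_top at_top"
    unfolding filterlim_at_top
  proof
    fix M
    obtain D where D: "\<forall>x\<in>X. \<forall>y\<in>X. D \<le> d x y \<longrightarrow> M \<le> N x y" using lower[of M] by (auto simp: N_def)
    show "\<forall>\<^sub>F r in at_top. M \<le> \<rho>1 r"
      using eventually_ge_at_top[of "max M D"]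
    proof eventually_elim
      case (elim r)
      show ?case unfolding \<rho>1_def using D elim by (intro cInf_greatest) (auto simp: S_def)
    qed
  qed
  moreover have "filterlim \<rho>2 at_top at_top"
    by (rule filterlim_at_top_mono[OF filterlim_ident]) (simp add: \<rho>2_def add_increasing2 T0)
  moreover have "\<rho>1 (d x y) \<le> N x y \<and> N x y \<le> \<rho>2 (d x y)"
    if "x \<in> X" "y \<in> X" for x y
  proof
    show "\<rho>1 (d x y) \<le> N x y"
      unfolding \<rho>1_def by (rule cInf_lower[OF _ S]) (use that in \<open>auto simp: S_def\<close>)
    have "N x y \<le> Sup (T (d x y))"
      by (rule cSup_upper[OF _ T]) (use that in \<open>auto simp: T_def\<close>)
    then show "N x y \<le> \<rho>2 (d x y)" by (simp add: \<rho>2_def)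
  qed
  ultimately show ?thesis
    unfolding coarsely_embeddable_def using H \<phi>
    by (intro exI[of _ V] exI[of _ ip] exI[of _ \<phi>] exI[of _ \<rho>1] exI[of _ \<rho>2]) (auto simp: N_def)
qed

text \<open>The condition \<open>near\<close> makes the series of \<open>1 - k m\<close> converge
  with a bound depending only on the distance. By \<open>far\<close>, any prescribed number of its
  terms is at least 1/2 at large distance, so the sum is proper.\<close>

lemma coarsely_embeddable_from_kernels:
  assumes X: "countable X" "p \<in> X"
    and psd: "\<And>m. psd_kernel X (k m)"
    and diag: "\<And>m x. x \<in> X \<Longrightarrow> k m x x = 1"
    and range: "\<And>m x y. x \<in> X \<Longrightarrow> y \<in> X \<Longrightarrow> 0 \<le> k m x y \<and> k m x y \<le> 1"
    and near: "\<And>m x y. x \<in> X \<Longrightarrow> y \<in> X \<Longrightarrow> d x y \<le> real m \<Longrightarrow> 1 - (1/2)^m \<le> k m x y"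
    and far: "\<And>m. \<exists>D. \<forall>x\<in>X. \<forall>y\<in>X. D \<le> d x y \<longrightarrow> k m x y \<le> 1/2"
  shows "coarsely_embeddable TYPE(nat \<Rightarrow>\<^sub>C real) X d"
proof -
  define \<psi> where "\<psi> x y = (\<Sum>m. 1 - k m x y)" for x y
  \<comment> \<open>Below index \<open>m0\<close> the trivial bound 1 is used, from there on
    \<open>near\<close>; the majorant sums to \<open>m0 + 2\<close>.\<close>
  have bound: "1 - k m x y \<le> (if m < m0 then 1 else 0) + (1/2)^m"
    if "x \<in> X" "y \<in> X" "d x y \<le> real m0" for x y m m0
    using range[OF that(1,2), of m] near[OF that(1,2), of m] that(3)
    by (cases "m < m0") (auto simp: add_increasing2)
  have majorant: "(\<lambda>m. (if m < m0 then 1 else 0) + (1/2)^m :: real) sums (real m0 + 2)" for m0 :: nat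
  proof (rule sums_add)
    show "(\<lambda>m. if m < m0 then 1 else 0 :: real) sums real m0"
      using sums_If_finite_set[of "{..<m0}" "\<lambda>_. 1 :: real"] by simp
    show "(\<lambda>m. (1/2)^m :: real) sums 2" using geometric_sums[of "1/2 :: real"] by simp
  qed
  have \<psi>_summable: "summable (\<lambda>m. 1 - k m x y)" if "x \<in> X" "y \<in> X" for x y
  proof (rule summable_comparison_test')
    define m0 where "m0 = nat \<lceil>d x y\<rceil>"
    show "summable (\<lambda>m. (if m < m0 then 1 else 0) + (1/2)^m :: real)"
      using majorant sums_summable by blast
    show "norm (1 - k m x y) \<le> (if m < m0 then 1 else 0) + (1/2)^m" for m
      using bound[OF that, of m0 m] range[OF that, of m] real_nat_ceiling_ge[of "d x y"]
      by (simp add: m0_def)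
  qed
  have \<psi>_sums: "(\<lambda>m. 1 - k m x y) sums \<psi> x y" if "x \<in> X" "y \<in> X" for x y
    unfolding \<psi>_def using \<psi>_summable[OF that] by (rule summable_sums)
  have \<psi>_le: "\<psi> x y \<le> real m0 + 2" if "x \<in> X" "y \<in> X" "d x y \<le> real m0" for x y m0
    using sums_le[OF bound[OF that] \<psi>_sums[OF that(1,2)] majorant] .
  have \<psi>_ge: "real m / 2 \<le> \<psi> x y" if "x \<in> X" "y \<in> X" "\<And>j. j < m \<Longrightarrow> k j x y \<le> 1/2" for x y m
  proof -
    have "real m / 2 = (\<Sum>j<m. 1/2)" by simp
    also have "\<dots> \<le> (\<Sum>j<m. 1 - k j x y)" using that(3) by (intro sum_mono) force
    also have "\<dots> \<le> \<psi> x y"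
      unfolding \<psi>_def using range[OF that(1,2)] by (intro sum_le_suminf \<psi>_summable that) auto
    finally show ?thesis .
  qed
  \<comment> \<open>Twice the Gromov product of \<psi> at the base point \<open>p\<close>. Without
    the factor 1/2, the squared distance of the resulting vectors is
    \<open>2 * \<psi> x y\<close>.\<close>
  define K where "K x y = \<psi> x p + \<psi> p y - \<psi> x y" for x y
  have K: "psd_kernel X K"
  proof (rule psd_kernel_sums)
    show "psd_kernel X (\<lambda>x y. k m x y - k m x p - k m p y + k m p p)" for m
      by (rule psd_kernel_recenter[OF psd X(2)])
    fix x y assume "x \<in> X" "y \<in> X"
    \<comment> \<open>Since \<open>k m p p = 1\<close>, each term is the kernel \<open>k m\<close>
      recentered at \<open>p\<close>.\<close>
    then have "(\<lambda>m. (1 - k m x p) + (1 - k m p y) - (1 - k m x y)) sums K x y"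
      unfolding K_def using X by (intro sums_add sums_diff \<psi>_sums)
    then show "(\<lambda>m. k m x y - k m x p - k m p y + k m p p) sums K x y"
      using X by (simp add: diag algebra_simps)
  qed
  obtain L :: "'a \<Rightarrow> nat \<Rightarrow> real" and N :: "'a \<Rightarrow> nat"
    where L0: "\<And>x j. x \<in> X \<Longrightarrow> N x \<le> j \<Longrightarrow> L x j = 0"
      and L: "\<And>x y m. x \<in> X \<Longrightarrow> y \<in> X \<Longrightarrow> N x \<le> m \<Longrightarrow> K x y = (\<Sum>j<m. L x j * L y j)"
    by (rule psd_kernel_factorization[OF X(1) K]) (rule that)
  have "\<exists>f\<in>ell2. apply_bcontfun f = L x" if "x \<in> X" for x
    by (rule ex_ell2_sequence, rule summable_finite[of "{..<N x}"]) (use L0[OF that] in auto)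
  then obtain \<phi> where \<phi>: "\<And>x. x \<in> X \<Longrightarrow> \<phi> x \<in> ell2" "\<And>x. x \<in> X \<Longrightarrow> apply_bcontfun (\<phi> x) = L x"
    by metis
  have inner: "ell2_inner (\<phi> x) (\<phi> y) = K x y" if "x \<in> X" "y \<in> X" for x y
  proof -
    have "ell2_inner (\<phi> x) (\<phi> y) = (\<Sum>j. L x j * L y j)" using that \<phi> by (simp add: ell2_inner_eq)
    also have "\<dots> = (\<Sum>j<N x. L x j * L y j)" by (rule suminf_finite) (use L0 that in auto)
    finally show ?thesis using L[OF that order_refl] by simp
  qed
  have norm: "(ip_norm ell2_inner (\<phi> x - \<phi> y))\<^sup>2 = 2 * \<psi> x y" if "x \<in> X" "y \<in> X" for x y
  proof -
    have "\<psi> z z = 0" if "z \<in> X" for z by (simp add: \<psi>_def diag that)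
    moreover have "\<psi> p z = \<psi> z p" if "z \<in> X" for z
      unfolding \<psi>_def using psd_kernel_sym[OF psd X(2) that] by simp
    ultimately show ?thesis
      using that ip_norm_diff_square[OF hilbert_space_on_ell2 \<phi>(1) \<phi>(1), of x y]
      by (simp add: inner K_def)
  qed
  show ?thesis
  proof (rule coarsely_embeddableI[OF hilbert_space_on_ell2])
    show "\<phi> ` X \<subseteq> ell2" using \<phi> by auto
    fix r :: real
    have "ip_norm ell2_inner (\<phi> x - \<phi> y) \<le> sqrt (2 * (real (nat \<lceil>r\<rceil>) + 2))"
      if "x \<in> X" "y \<in> X" "d x y \<le> r" for x y
    proof (rule real_le_rsqrt)
      have "d x y \<le> real (nat \<lceil>r\<rceil>)" using that by linarith
      then show "(ip_norm ell2_inner (\<phi> x - \<phi> y))\<^sup>2 \<le> 2 * (real (nat \<lceil>r\<rceil>) + 2)"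
        using \<psi>_le[of x y "nat \<lceil>r\<rceil>"] that norm by simp
    qed
    then show "\<exists>B. \<forall>x\<in>X. \<forall>y\<in>X. d x y \<le> r \<longrightarrow> ip_norm ell2_inner (\<phi> x - \<phi> y) \<le> B" by blast
  next
    fix M :: real
    obtain D where D: "\<And>m x y. x \<in> X \<Longrightarrow> y \<in> X \<Longrightarrow> D m \<le> d x y \<Longrightarrow> k m x y \<le> 1/2"
      using far by metis
    define m where "m = nat \<lceil>M\<^sup>2\<rceil>"
    \<comment> \<open>Beyond the sum of all \<open>\<bar>D j\<bar>\<close> the first
      \<open>m\<close> kernels are at most 1/2, so the squared norm is at least \<open>m\<close>,
      which was chosen to be at least the square of \<open>M\<close>.\<close>
    have "M \<le> ip_norm ell2_inner (\<phi> x - \<phi> y)"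
      if xy: "x \<in> X" "y \<in> X" "(\<Sum>j<m. \<bar>D j\<bar>) \<le> d x y" for x y
    proof (rule power2_le_imp_le)
      have "k j x y \<le> 1/2" if "j < m" for j
      proof (rule D[OF xy(1,2)])
        have "\<bar>D j\<bar> \<le> (\<Sum>j<m. \<bar>D j\<bar>)" using that by (intro member_le_sum) auto
        then show "D j \<le> d x y" using xy(3) by linarith
      qed
      then have "real m \<le> 2 * \<psi> x y" using \<psi>_ge[OF xy(1,2), of m] by simp
      moreover have "M\<^sup>2 \<le> real m" unfolding m_def by linarith
      ultimately show "M\<^sup>2 \<le> (ip_norm ell2_inner (\<phi> x - \<phi> y))\<^sup>2" using norm xy by simp
      show "0 \<le> ip_norm ell2_inner (\<phi> x - \<phi> y)" by (simp add: ip_norm_def ell2_inner_nonneg)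
    qed
    then show "\<exists>D. \<forall>x\<in>X. \<forall>y\<in>X. D \<le> d x y \<longrightarrow> M \<le> ip_norm ell2_inner (\<phi> x - \<phi> y)" by blast
  qed
qed

section \<open>Kernels from relative property A\<close>

text \<open>A single translation carries the whole coset into the subgroup; under a left-invariant
  metric it keeps all distances between points of the coset.\<close>

lemma (in group) lcosets_representative:
  assumes "subgroup H G" "C \<in> lcosets H"
  shows "\<exists>g. g \<in> carrier G \<and> (\<forall>c\<in>C. c \<in> carrier G \<and> inv g \<otimes> c \<in> H)"
proof -
  obtain g where g: "g \<in> carrier G" "C = g <# H" using assms by (auto simp: LCOSETS_def)
  have "c \<in> carrier G \<and> inv g \<otimes> c \<in> H" if c: "c \<in> C" for c
  proof -
    obtain h where h: "h \<in> H" "c = g \<otimes> h" using c unfolding g(2) l_coset_def by auto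
    have "h \<in> carrier G" by (rule subgroup.mem_carrier[OF assms(1) h(1)])
    then show ?thesis using g(1) h by (simp add: m_assoc[symmetric])
  qed
  then show ?thesis using g by blast
qed

text \<open>If \<open>x\<close> and \<open>y\<close> share an index, their nearby coset points are
  moved into the subgroup by the same translation, so \<open>d x y\<close> changes by at most
  \<open>2 * S\<close>. As there are finitely many subgroups, their control functions can be bounded
  uniformly.\<close>

lemma ex_kernel_relative_property_A:
  fixes G :: "('a, 'b) monoid_scheme" (structure)
  assumes G: "group G" "countable (carrier G)" "Metric_space (carrier G) d" "left_invariant G d"
    and H: "\<And>i. i \<in> {1..n} \<Longrightarrow> subgroup (H i) G"
    and rel: "relative_property_A G d n H"
    and emb: "\<And>i. i \<in> {1..n} \<Longrightarrow> coarsely_embeddable TYPE('v::real_vector) (H i) d"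
    and R: "0 < R" and \<epsilon>: "0 < \<epsilon>" "\<epsilon> \<le> 1"
  shows "\<exists>k. psd_kernel (carrier G) k \<and> (\<forall>x\<in>carrier G. k x x = 1) \<and>
             (\<forall>x\<in>carrier G. \<forall>y\<in>carrier G. 0 \<le> k x y \<and> k x y \<le> 1) \<and>
             (\<forall>x\<in>carrier G. \<forall>y\<in>carrier G. d x y < R \<longrightarrow> 1 - 2 * \<epsilon> \<le> k x y) \<and>
             (\<exists>D. \<forall>x\<in>carrier G. \<forall>y\<in>carrier G. D \<le> d x y \<longrightarrow> k x y \<le> 1/2)"
proof -
  interpret group G by fact
  interpret Metric_space "carrier G" d by fact
  \<comment> \<open>Naming the body of coarse embeddability lets all five witnesses be chosen at
    once as functions of \<open>i\<close>.\<close>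
  define Q where "Q i V ip \<phi> \<rho>1 \<rho>2 \<longleftrightarrow>
      hilbert_space_on V ip \<and> \<phi> ` H i \<subseteq> V \<and>
      mono_on {0..} \<rho>1 \<and> mono_on {0..} \<rho>2 \<and>
      filterlim \<rho>1 at_top at_top \<and> filterlim \<rho>2 at_top at_top \<and>
      (\<forall>x\<in>H i. \<forall>y\<in>H i. \<rho>1 (d x y) \<le> ip_norm ip (\<phi> x - \<phi> y) \<and>
                     ip_norm ip (\<phi> x - \<phi> y) \<le> \<rho>2 (d x y))"
    for i and V :: "'v set" and ip \<phi> and \<rho>1 \<rho>2 :: "real \<Rightarrow> real"
  have "\<exists>V ip \<phi> \<rho>1 \<rho>2. Q i V ip \<phi> \<rho>1 \<rho>2" if "i \<in> {1..n}" for i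
    using emb[OF that] unfolding coarsely_embeddable_def Q_def .
  then obtain V ip \<phi> \<rho>1 \<rho>2 where Q: "\<And>i. i \<in> {1..n} \<Longrightarrow> Q i (V i) (ip i) (\<phi> i) (\<rho>1 i) (\<rho>2 i)"
    by metis
  note hilb = Q[unfolded Q_def, THEN conjunct1]
  have \<phi>: "\<phi> i h \<in> V i" if "i \<in> {1..n}" "h \<in> H i" for i h
    using Q[OF that(1)] that(2) unfolding Q_def by blast
  have mono: "\<rho>2 i r \<le> \<rho>2 i s" if "i \<in> {1..n}" "0 \<le> r" "r \<le> s" for i r s
    using Q[OF that(1)] that(2,3) unfolding Q_def by (auto elim: mono_onD)
  have lim: "filterlim (\<rho>1 i) at_top at_top" if "i \<in> {1..n}" for i
    using Q[OF that] unfolding Q_def by blast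
  have ctrl: "\<rho>1 i (d h h') \<le> ip_norm (ip i) (\<phi> i h - \<phi> i h')"
    "ip_norm (ip i) (\<phi> i h - \<phi> i h') \<le> \<rho>2 i (d h h')"
    if "i \<in> {1..n}" "h \<in> H i" "h' \<in> H i" for i h h'
    using Q[OF that(1)] that(2,3) unfolding Q_def by blast+
  obtain S and A :: "'a \<Rightarrow> ((nat \<times> 'a set) \<times> nat) set" where S: "0 < S"
    and A: "\<forall>x\<in>carrier G. finite (A x) \<and> A x \<noteq> {} \<and> A x \<subseteq> coset_union G n H \<times> UNIV"
    and close: "\<forall>x\<in>carrier G. \<forall>y\<in>carrier G. d x y < R \<longrightarrow>
        real (card (sym_diff (A x) (A y))) / real (card (A x)) < \<epsilon>"
    and INF: "\<forall>x\<in>carrier G. \<forall>i C j. ((i, C), j) \<in> A x \<longrightarrow> (INF c\<in>C. d x c) < S"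
    using rel[unfolded relative_property_A_def, rule_format, OF R \<epsilon>(1)]
    by (elim exE conjE) (rule that)
  define pt where "pt x C = (SOME c. c \<in> C \<and> d x c < S)" for x C
  define rep where "rep i C = (SOME g. g \<in> carrier G \<and> (\<forall>c\<in>C. c \<in> carrier G \<and> inv g \<otimes> c \<in> H i))" for i C
  define h where "h a x = inv (rep (fst (fst a)) (snd (fst a))) \<otimes> pt x (snd (fst a))"
    for a :: "(nat \<times> 'a set) \<times> nat" and x
  have idx: "fst (fst a) \<in> {1..n}" and hH: "h a x \<in> H (fst (fst a))"
    and rep: "rep (fst (fst a)) (snd (fst a)) \<in> carrier G"
    and pt: "pt x (snd (fst a)) \<in> carrier G" "d x (pt x (snd (fst a))) < S"
    if "x \<in> carrier G" "a \<in> A x" for a x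
  proof -
    obtain i C j where a: "a = ((i, C), j)" by (metis prod.exhaust)
    have i: "i \<in> {1..n}" and C: "C \<in> lcosets (H i)"
      using bspec[OF A that(1)] that(2) by (auto simp: a coset_union_def)
    have "rep i C \<in> carrier G \<and> (\<forall>c\<in>C. c \<in> carrier G \<and> inv (rep i C) \<otimes> c \<in> H i)"
      unfolding rep_def by (rule someI_ex[OF lcosets_representative[OF H[OF i] C]])
    moreover have "C \<noteq> {}"
      using C lcos_self[OF _ H[OF i]] by (auto simp: LCOSETS_def)
    \<comment> \<open>The coset is nonempty, so an infimum below \<open>S\<close> yields an actual
      point at distance less than \<open>S\<close>.\<close>
    then have "\<exists>c. c \<in> C \<and> d x c < S"
      using cInf_lessD[OF _ INF[rule_format, OF that(1) that(2)[unfolded a]]] by auto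
    then have "pt x C \<in> C \<and> d x (pt x C) < S" unfolding pt_def by (rule someI_ex)
    ultimately show "fst (fst a) \<in> {1..n}" "h a x \<in> H (fst (fst a))"
      "rep (fst (fst a)) (snd (fst a)) \<in> carrier G"
      "pt x (snd (fst a)) \<in> carrier G" "d x (pt x (snd (fst a))) < S"
      using i by (auto simp: a h_def)
  qed
  have dh: "d (h a x) (h a y) \<le> d x y + 2 * S" "d x y - 2 * S \<le> d (h a x) (h a y)"
    if xy: "x \<in> carrier G" "y \<in> carrier G" "a \<in> A x \<inter> A y" for x y a
  proof -
    define x' where "x' = pt x (snd (fst a))"
    define y' where "y' = pt y (snd (fst a))"
    have x': "x' \<in> carrier G" "d x x' < S" and y': "y' \<in> carrier G" "d y y' < S"
      unfolding x'_def y'_def using pt[of x a] pt[of y a] that by auto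
    have "d (h a x) (h a y) = d x' y'"
      using G(4) rep[of x a] x' y' that
      unfolding left_invariant_def h_def x'_def[symmetric] y'_def[symmetric] by auto
    moreover have "d x' y' \<le> d x' x + d x y + d y y'"
      using triangle[of x' x y'] triangle[of x y y'] xy x' y' by linarith
    moreover have "d x y \<le> d x x' + d x' y' + d y' y"
      using triangle[of x x' y] triangle[of x' y' y] xy x' y' by linarith
    ultimately show "d (h a x) (h a y) \<le> d x y + 2 * S" "d x y - 2 * S \<le> d (h a x) (h a y)"
      using x' y' commute[of x x'] commute[of y y'] by linarith+
  qed
  define i where "i a = fst (fst a)" for a :: "(nat \<times> 'a set) \<times> nat"
  \<comment> \<open>At distance below \<open>R\<close> the translated points are within
    \<open>R + 2 * S\<close>; the sum of squares dominates each summand and thus serves all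
    subgroups.\<close>
  define B where "B = (\<Sum>j\<in>{1..n}. (\<rho>2 j (R + 2 * S))\<^sup>2)"
  show ?thesis
  proof (rule ex_overlap_kernel[where A = A and V = "\<lambda>a. V (i a)" and ip = "\<lambda>a. ip (i a)"
        and u = "\<lambda>a x. \<phi> (i a) (h a x)" and B = B])
    fix x y a assume xy: "x \<in> carrier G" "y \<in> carrier G" "a \<in> A x \<inter> A y" "d x y < R"
    have ia: "i a \<in> {1..n}" and hx: "h a x \<in> H (i a)" and hy: "h a y \<in> H (i a)"
      unfolding i_def using idx hH xy by auto
    have "ip_norm (ip (i a)) (\<phi> (i a) (h a x) - \<phi> (i a) (h a y)) \<le> \<rho>2 (i a) (d (h a x) (h a y))"
      by (rule ctrl(2)[OF ia hx hy])
    also have "\<dots> \<le> \<rho>2 (i a) (R + 2 * S)"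
      using dh(1)[OF xy(1-3)] xy(4) by (intro mono[OF ia]) auto
    finally have "(ip_norm (ip (i a)) (\<phi> (i a) (h a x) - \<phi> (i a) (h a y)))\<^sup>2 \<le> (\<rho>2 (i a) (R + 2 * S))\<^sup>2"
      using ip_norm_diff_nonneg[OF hilb[OF ia] \<phi>[OF ia hx] \<phi>[OF ia hy]] by (intro power_mono)
    also have "\<dots> \<le> B" unfolding B_def using ia by (intro member_le_sum) auto
    finally show "(ip_norm (ip (i a)) (\<phi> (i a) (h a x) - \<phi> (i a) (h a y)))\<^sup>2 \<le> B" .
  next
    fix M :: real
    \<comment> \<open>One threshold for the finitely many lower control functions; the root of
      \<open>\<bar>M\<bar>\<close> is a bound whose square is at least \<open>M\<close>, also for
      negative \<open>M\<close>.\<close>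
    have "\<forall>\<^sub>F r in at_top. \<forall>j\<in>{1..n}. sqrt \<bar>M\<bar> \<le> \<rho>1 j r"
      using lim by (intro eventually_ball_finite) (auto simp: filterlim_at_top)
    then obtain D where D: "\<And>r j. D \<le> r \<Longrightarrow> j \<in> {1..n} \<Longrightarrow> sqrt \<bar>M\<bar> \<le> \<rho>1 j r"
      unfolding eventually_at_top_linorder by blast
    \<comment> \<open>The shift by \<open>2 * S\<close> pays for the passage from \<open>x\<close>
      and \<open>y\<close> to the translated points.\<close>
    have "M \<le> (ip_norm (ip (i a)) (\<phi> (i a) (h a x) - \<phi> (i a) (h a y)))\<^sup>2"
      if xy: "x \<in> carrier G" "y \<in> carrier G" "a \<in> A x \<inter> A y" "D + 2 * S \<le> d x y" for x y a
    proof -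
      have ia: "i a \<in> {1..n}" and hx: "h a x \<in> H (i a)" and hy: "h a y \<in> H (i a)"
        unfolding i_def using idx hH xy by auto
      have "sqrt \<bar>M\<bar> \<le> \<rho>1 (i a) (d (h a x) (h a y))"
        using dh(2)[OF xy(1-3)] xy(4) by (intro D ia) linarith
      also have "\<dots> \<le> ip_norm (ip (i a)) (\<phi> (i a) (h a x) - \<phi> (i a) (h a y))"
        by (rule ctrl(1)[OF ia hx hy])
      finally show ?thesis using sqrt_le_D by fastforce
    qed
    then show "\<exists>D. \<forall>x\<in>carrier G. \<forall>y\<in>carrier G. \<forall>a\<in>A x \<inter> A y. D \<le> d x y \<longrightarrow>
        M \<le> (ip_norm (ip (i a)) (\<phi> (i a) (h a x) - \<phi> (i a) (h a y)))\<^sup>2" by blast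
  next
    fix a x assume "x \<in> carrier G" "a \<in> A x"
    then show "hilbert_space_on (V (i a)) (ip (i a)) \<and> \<phi> (i a) (h a x) \<in> V (i a)"
      using hilb \<phi> idx hH unfolding i_def by blast
  qed (use G(2) A close \<epsilon> commute in auto)
qed

theorem corollary4p9:
  fixes G :: "('a, 'b) monoid_scheme"
    and d :: "'a \<Rightarrow> 'a \<Rightarrow> real"
    and n :: nat
    and H :: "nat \<Rightarrow> 'a set"
  assumes "group G"
    and "countable (carrier G)"
    and "Metric_space (carrier G) d"
    and "uniformly_discrete (carrier G) d"
    and "proper_metric (carrier G) d"
    and "left_invariant G d"
    and "\<And>i. i \<in> {1..n} \<Longrightarrow> subgroup (H i) G"
    and "relative_property_A G d n H"
    and "\<And>i. i \<in> {1..n} \<Longrightarrow> coarsely_embeddable TYPE('v::real_vector) (H i) d"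
  shows "coarsely_embeddable TYPE(nat \<Rightarrow>\<^sub>C real) (carrier G) d"
proof -
  \<comment> \<open>The radius \<open>real m + 1\<close> is positive for every \<open>m\<close> and
    turns the later bound \<open>d x y \<le> real m\<close> into a strict one. The exponent
    \<open>Suc m\<close> absorbs the factor 2 in the error.\<close>
  define P where "P m k \<longleftrightarrow> psd_kernel (carrier G) k \<and> (\<forall>x\<in>carrier G. k x x = 1) \<and>
      (\<forall>x\<in>carrier G. \<forall>y\<in>carrier G. 0 \<le> k x y \<and> k x y \<le> 1) \<and>
      (\<forall>x\<in>carrier G. \<forall>y\<in>carrier G. d x y < real m + 1 \<longrightarrow> 1 - 2 * (1/2) ^ Suc m \<le> k x y) \<and>
      (\<exists>D. \<forall>x\<in>carrier G. \<forall>y\<in>carrier G. D \<le> d x y \<longrightarrow> k x y \<le> 1/2)" for m and k :: "'a \<Rightarrow> 'a \<Rightarrow> real"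
  have "\<exists>k. P m k" for m
    unfolding P_def
    by (rule ex_kernel_relative_property_A[OF assms(1-3,6-9)]) (auto intro: power_le_one simp del: power_Suc)
  then obtain k where k: "\<And>m. P m (k m)" by metis
  show ?thesis
  proof (rule coarsely_embeddable_from_kernels[where k = k])
    \<comment> \<open>The identity serves as the base point for recentering.\<close>
    show "\<one>\<^bsub>G\<^esub> \<in> carrier G" using assms(1) by (simp add: group.is_monoid)
    show "psd_kernel (carrier G) (k m)" for m using k[of m] unfolding P_def by blast
    show "\<exists>D. \<forall>x\<in>carrier G. \<forall>y\<in>carrier G. D \<le> d x y \<longrightarrow> k m x y \<le> 1/2" for m
      using k[of m] unfolding P_def by blast
    fix m x assume x: "x \<in> carrier G"
    show "k m x x = 1" using k[of m] x unfolding P_def by blast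
    fix y assume y: "y \<in> carrier G"
    show "0 \<le> k m x y \<and> k m x y \<le> 1" using k[of m] x y unfolding P_def by blast
    assume "d x y \<le> real m"
    then show "1 - (1/2) ^ m \<le> k m x y" using k[of m] x y unfolding P_def by simp
  qed fact
qed

end
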